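(* Let $k\ge 1$ be an integer, $x\in\{3,5\}$ and $\theta = 2\pi/(4k+x)$. For every finite point set $P$ in general position and every set of constraints $S$ on $P$, the constrained $\theta_{(4k+x)}$-graph of $P$ with respect to $S$ is a $\frac{\cos\left(\frac{\theta}{4}\right)}{\cos\left(\frac{\theta}{2}\right) - \sin\left(\frac{3\theta}{4}\right)}$-spanner of the visibility graph $\mathrm{Vis}(P,S)$.
   Context: $P$ is a finite set of points in the plane and $S$ is a set of line segments (called constraints), each joining two points of $P$, such that no two constraints intersect properly. Two points $u,v\in P$ can see each other if and only if the segment $uv$ does not properly intersect any constraint or $uv$ is itself a constraint. The visibility graph $\mathrm{Vis}(P,S)$ has vertex set $P$ and an edge $uv$ for every pair of points that can see each other, weighted by Euclidean length. Fix an integer $k\ge 1$, $x\in\{2,3,4,5\}$ and $\theta=2\pi/(4k+x)$. Around each point $u$, the $4k+x$ rays from $u$ with angle $\theta$ between consecutive rays define cones; they are oriented so that the bisector of one cone, $C_0^u$, is the vertical half-line above $u$, and the cones are numbered $C_0^u, C_1^u, \dots$ clockwise; all points use the same orientation. For every constraint $uv$ with $v\in C_i^u$, the line through that constraint splits $C_i^u$; the resulting pieces are the subcones of $C_i^u$ (if a constraint $uv$ splits a cone of $u$ into two subcones, $v$ is considered to lie in both; a cone not split is a single subcone). The constrained $\theta_{(4k+x)}$-graph has vertex set $P$ and, for each vertex $u$ and each subcone of each cone $C_i^u$, an edge between $u$ and the vertex $v$ of that subcone that can see $u$ and whose orthogonal projection onto the bisector of the full cone $C_i^u$ (not of the subcone)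 is closest to $u$ among all vertices of that subcone that can see $u$. Edges are weighted by Euclidean length. General position: no two points lie on a line parallel to one of the rays defining the cones, no two points lie on a line perpendicular to the bisector of a cone, and no three points are collinear. A subgraph $H$ of a weighted graph $G$ is a $t$-spanner of $G$ ($t\ge 1$) if for all vertices $u,v$, $d_H(u,v)\le t\cdot d_G(u,v)$, where $d$ denotes shortest-path distance. *)

theory Defs
  imports "HOL-Analysis.Analysis" "HOL-Library.Extended_Real"
begin

type_synonym pt = "real \<times> real"

text \<open>Unit direction making clockwise angle \<open>\<alpha>\<close> with the upward vertical.\<close>
definition cone_dir :: "real \<Rightarrow> pt" where
  "cone_dir \<alpha> = (sin \<alpha>, cos \<alpha>)"

text \<open>Bisector of cone \<open>C_i\<close> when there are \<open>n\<close> cones (\<open>\<theta> = 2\<pi>/n\<close>), numbered clockwise,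
  \<open>C_0\<close> bisected by the upward vertical.\<close>
definition bisector :: "nat \<Rightarrow> nat \<Rightarrow> pt" where
  "bisector n i = cone_dir (real i * (2 * pi / real n))"

definition in_cone :: "nat \<Rightarrow> nat \<Rightarrow> pt \<Rightarrow> pt \<Rightarrow> bool" where
  "in_cone n i u v \<longleftrightarrow> v \<noteq> u \<and> (v - u) \<bullet> bisector n i \<ge> norm (v - u) * cos (pi / real n)"

definition cross :: "pt \<Rightarrow> pt \<Rightarrow> real" where
  "cross a b = fst a * snd b - snd a * fst b"

definition proper_cross :: "pt \<Rightarrow> pt \<Rightarrow> pt \<Rightarrow> pt \<Rightarrow> bool" where
  "proper_cross a b c d \<longleftrightarrow>
     (\<exists>p. closed_segment a b \<inter> closed_segment c d = {p} \<and> p \<notin> {a, b, c, d})"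

definition constraints :: "pt set \<Rightarrow> pt set set \<Rightarrow> bool" where
  "constraints P S \<longleftrightarrow>
     (\<forall>s\<in>S. \<exists>a\<in>P. \<exists>b\<in>P. a \<noteq> b \<and> s = {a, b}) \<and>
     (\<forall>s\<in>S. \<forall>s'\<in>S. \<forall>a b c d. s = {a, b} \<longrightarrow> s' = {c, d} \<longrightarrow> \<not> proper_cross a b c d)"

definition visible :: "pt set set \<Rightarrow> pt \<Rightarrow> pt \<Rightarrow> bool" where
  "visible S u v \<longleftrightarrow>
     {u, v} \<in> S \<or> (\<forall>s\<in>S. \<forall>c d. s = {c, d} \<longrightarrow> \<not> proper_cross u v c d)"

definition vis_graph :: "pt set \<Rightarrow> pt set set \<Rightarrow> pt \<Rightarrow> pt \<Rightarrow> bool" where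
  "vis_graph P S u v \<longleftrightarrow> u \<in> P \<and> v \<in> P \<and> u \<noteq> v \<and> visible S u v"

definition separated :: "nat \<Rightarrow> pt set set \<Rightarrow> pt \<Rightarrow> nat \<Rightarrow> pt \<Rightarrow> pt \<Rightarrow> bool" where
  "separated n S u i z z' \<longleftrightarrow>
     (\<exists>w. {u, w} \<in> S \<and> in_cone n i u w \<and> cross (w - u) (z - u) * cross (w - u) (z' - u) < 0)"

text \<open>Subcones of \<open>C_i^u\<close>: maximal subsets of the cone not split by any constraint line
  (points on a splitting line belong to both adjacent subcones).\<close>
definition unsplit :: "nat \<Rightarrow> pt set set \<Rightarrow> pt \<Rightarrow> nat \<Rightarrow> pt set \<Rightarrow> bool" where
  "unsplit n S u i Z \<longleftrightarrow>
     Z \<subseteq> {z. in_cone n i u z} \<and> (\<forall>z\<in>Z. \<forall>z'\<in>Z. \<not> separated n S u i z z')"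

definition subcone :: "nat \<Rightarrow> pt set set \<Rightarrow> pt \<Rightarrow> nat \<Rightarrow> pt set \<Rightarrow> bool" where
  "subcone n S u i Z \<longleftrightarrow>
     unsplit n S u i Z \<and> (\<forall>Z'. Z \<subseteq> Z' \<and> unsplit n S u i Z' \<longrightarrow> Z' = Z)"

definition theta_half :: "nat \<Rightarrow> pt set \<Rightarrow> pt set set \<Rightarrow> pt \<Rightarrow> pt \<Rightarrow> bool" where
  "theta_half n P S u v \<longleftrightarrow>
     u \<in> P \<and> v \<in> P \<and> v \<noteq> u \<and> visible S u v \<and>
     (\<exists>i<n. \<exists>Z. subcone n S u i Z \<and> v \<in> Z \<and>
        (\<forall>v'\<in>P. v' \<in> Z \<and> v' \<noteq> u \<and> visible S u v' \<longrightarrow>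
            (v - u) \<bullet> bisector n i \<le> (v' - u) \<bullet> bisector n i))"

definition theta_graph :: "nat \<Rightarrow> pt set \<Rightarrow> pt set set \<Rightarrow> pt \<Rightarrow> pt \<Rightarrow> bool" where
  "theta_graph n P S u v \<longleftrightarrow> theta_half n P S u v \<or> theta_half n P S v u"

definition general_position :: "nat \<Rightarrow> pt set \<Rightarrow> bool" where
  "general_position n P \<longleftrightarrow>
     (\<forall>u\<in>P. \<forall>v\<in>P. u \<noteq> v \<longrightarrow>
        (\<forall>j<n. cross (v - u) (cone_dir (real (2 * j + 1) * pi / real n)) \<noteq> 0) \<and>
        (\<forall>i<n. (v - u) \<bullet> bisector n i \<noteq> 0)) \<and>
     (\<forall>u\<in>P. \<forall>v\<in>P. \<forall>w\<in>P. u \<noteq> v \<and> u \<noteq> w \<and> v \<noteq> w \<longrightarrow> \<not> collinear {u, v, w})"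

definition walk :: "(pt \<Rightarrow> pt \<Rightarrow> bool) \<Rightarrow> pt list \<Rightarrow> pt \<Rightarrow> pt \<Rightarrow> bool" where
  "walk E xs u v \<longleftrightarrow> xs \<noteq> [] \<and> hd xs = u \<and> last xs = v \<and>
     (\<forall>i. Suc i < length xs \<longrightarrow> E (xs ! i) (xs ! Suc i))"

definition walk_len :: "pt list \<Rightarrow> real" where
  "walk_len xs = (\<Sum>i<length xs - 1. dist (xs ! i) (xs ! Suc i))"

text \<open>Shortest-path distance (\<open>\<infinity>\<close> if no path).\<close>
definition gdist :: "(pt \<Rightarrow> pt \<Rightarrow> bool) \<Rightarrow> pt \<Rightarrow> pt \<Rightarrow> ereal" where
  "gdist E u v = (INF xs \<in> {xs. walk E xs u v}. ereal (walk_len xs))"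

definition is_spanner :: "pt set \<Rightarrow> (pt \<Rightarrow> pt \<Rightarrow> bool) \<Rightarrow> (pt \<Rightarrow> pt \<Rightarrow> bool) \<Rightarrow> real \<Rightarrow> bool" where
  "is_spanner P H G t \<longleftrightarrow> t \<ge> 1 \<and> (\<forall>u v. H u v \<longrightarrow> G u v) \<and>
     (\<forall>u\<in>P. \<forall>v\<in>P. gdist H u v \<le> ereal t * gdist G u v)"

end

theory Submission
  imports Defs
begin

text \<open>
  Let \<open>n = 4k + x\<close>, let \<open>t\<close> be the ratio, and let \<open>u\<close> and \<open>w\<close> see each other. As \<open>n\<close> is odd, the
  bisectors and their opposites are spaced by \<open>\<theta> / 2\<close>, so after exchanging \<open>u\<close> and \<open>w\<close> if
  necessary the segment \<open>uw\<close> makes an angle of at most \<open>\<theta> / 4\<close> with the bisector of its cone.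
  Let \<open>v\<close> be the neighbour of \<open>u\<close> in a subcone that contains \<open>w\<close>. Gift wrapping around \<open>v\<close>
  produces a chain of visibility edges from \<open>v\<close> to \<open>w\<close> that bulges towards \<open>u\<close>; its vertices
  are visible from \<open>u\<close> and lie in the same subcone, hence not below \<open>v\<close>. If \<open>q\<close> is the point of
  \<open>uw\<close> at the height of \<open>v\<close>, the chain is monotone in the directions \<open>vq\<close> and \<open>qw\<close>, so its
  length is at most \<open>|vq| + |qw|\<close>. The ratio is chosen such that
  \<open>|uv| + t (|vq| + |qw|) \<le> t |uw|\<close>. In particular all edges of the chain are shorter than \<open>uw\<close>,
  and induction on the length gives a path of length at most \<open>t |uw|\<close>.
\<close>

section \<open>Walks of bounded length\<close>

text \<open>A witness walk with a real length bound keeps infima and extended reals out of the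
  induction; \<open>gdist\<close> returns only in \<open>gdist_le_of_conn\<close>.\<close>

definition conn :: "(pt \<Rightarrow> pt \<Rightarrow> bool) \<Rightarrow> pt \<Rightarrow> pt \<Rightarrow> real \<Rightarrow> bool" where
  "conn E a b l \<longleftrightarrow> (\<exists>xs. walk E xs a b \<and> walk_len xs \<le> l)"

lemma walk_singleton [simp]: "walk E [x] a b \<longleftrightarrow> x = a \<and> x = b"
  by (auto simp: walk_def)

lemma walk_Cons_Cons [simp]:
  "walk E (x # y # zs) a b \<longleftrightarrow> x = a \<and> E x y \<and> walk E (y # zs) y b"
  unfolding walk_def
  by (auto simp: nth_Cons split: nat.splits)

lemma walk_Nil [simp]: "\<not> walk E [] a b"
  by (simp add: walk_def)

lemma walk_len_singleton [simp]: "walk_len [x] = 0"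
  by (simp add: walk_len_def)

lemma walk_len_Cons_Cons [simp]: "walk_len (x # y # zs) = dist x y + walk_len (y # zs)"
  by (simp add: walk_len_def sum.lessThan_Suc_shift del: sum.lessThan_Suc)

lemma conn_refl: "conn E a a 0"
  unfolding conn_def by (rule exI[of _ "[a]"]) simp

lemma conn_mono: "conn E a b l \<Longrightarrow> l \<le> l' \<Longrightarrow> conn E a b l'"
  unfolding conn_def by force

lemma conn_Cons:
  assumes "E a b" "conn E b c l"
  shows "conn E a c (dist a b + l)"
proof -
  obtain ys where ys: "walk E ys b c" "walk_len ys \<le> l"
    using assms(2) by (auto simp: conn_def)
  then obtain zs where "ys = b # zs"
    by (cases ys) (auto simp: walk_def)
  with ys assms(1) show ?thesis
    unfolding conn_def by (intro exI[of _ "a # ys"]) auto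
qed

lemma conn_edge: "E a b \<Longrightarrow> conn E a b (dist a b)"
  using conn_Cons[of E a b b 0] conn_refl[of E b] by simp

lemma walk_conn_trans:
  assumes "walk E xs a b" "conn E b c l"
  shows "conn E a c (walk_len xs + l)"
  using assms
proof (induction xs arbitrary: a rule: induct_list012)
  case (3 x y zs)
  then have "E a y" "conn E y c (walk_len (y # zs) + l)" "x = a"
    by auto
  with conn_Cons[OF this(1,2)] show ?case
    by (simp add: add.assoc)
qed auto

lemma conn_trans:
  assumes "conn E a b l" "conn E b c l'"
  shows "conn E a c (l + l')"
proof -
  obtain xs where xs: "walk E xs a b" "walk_len xs \<le> l"
    using assms(1) by (auto simp: conn_def)
  show ?thesis
    by (rule conn_mono[OF walk_conn_trans[OF xs(1) assms(2)]]) (use xs(2) in simp)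
qed

lemma conn_sym:
  assumes E: "\<And>x y. E x y \<Longrightarrow> E y x" and "conn E a b l"
  shows "conn E b a l"
proof -
  have "conn E b a (walk_len xs)" if "walk E xs a b" for xs
    using that
  proof (induction xs arbitrary: a rule: induct_list012)
    case (2 x)
    then show ?case by (auto simp: conn_refl)
  next
    case (3 x y zs)
    then have *: "conn E b y (walk_len (y # zs))" "E y a" "x = a"
      by (auto intro: E)
    show ?case
      using conn_trans[OF *(1) conn_edge[of E, OF *(2)]] *(3) by (simp add: dist_commute add.commute)
  qed auto
  with assms(2) show ?thesis
    unfolding conn_def[of E a] using conn_mono by blast
qed

lemma conn_walk_subst:
  assumes "\<And>a b. G a b \<Longrightarrow> conn H a b (t * dist a b)" "walk G xs a b"
  shows "conn H a b (t * walk_len xs)"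
  using assms(2)
proof (induction xs arbitrary: a rule: induct_list012)
  case (2 x)
  then show ?case by (auto simp: conn_refl)
next
  case (3 x y zs)
  then have "G a y" "conn H y b (t * walk_len (y # zs))" "x = a"
    by auto
  with conn_trans[OF assms(1)[OF this(1)] this(2)] show ?case
    by (simp add: distrib_left)
qed auto

text \<open>Bounding the detour of every single edge of \<open>G\<close> suffices, because the
  detours along a walk concatenate.\<close>

lemma gdist_le_of_conn:
  assumes "t > 0" "\<And>a b. G a b \<Longrightarrow> conn H a b (t * dist a b)"
  shows "gdist H a b \<le> ereal t * gdist G a b"
proof -
  have *: "gdist H a b \<le> ereal t * ereal (walk_len xs)" if walk: "walk G xs a b" for xs
  proof -
    obtain ys where ys: "walk H ys a b" "walk_len ys \<le> t * walk_len xs"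
      using conn_walk_subst[of G H t, OF assms(2) walk] by (auto simp: conn_def)
    then have "gdist H a b \<le> ereal (walk_len ys)"
      unfolding gdist_def by (intro INF_lower) auto
    with ys show ?thesis
      by (auto intro: order_trans)
  qed
  \<comment> \<open>With \<open>t\<close> moved to the left, the claim is a lower bound for an
    infimum over walks.\<close>
  have "gdist H a b / ereal t \<le> gdist G a b"
    unfolding gdist_def[of G]
    by (rule INF_greatest) (use * assms(1) in \<open>simp add: ereal_divide_le_pos\<close>)
  with assms(1) show ?thesis
    by (simp add: ereal_divide_le_pos)
qed

section \<open>Crossings and visibility\<close>

lemma cross_combination:
  "cross (a *\<^sub>R e + b *\<^sub>R f) (c *\<^sub>R e + d *\<^sub>R f) = (a * d - b * c) * cross e f"
  by (simp add: cross_def algebra_simps)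

lemma collinear_of_cross:
  assumes "cross (b - a) (c - a) = 0"
  shows "collinear {a, b, c}"
proof (cases "b = a")
  case True
  then show ?thesis by simp
next
  case False
  define k where "k = ((c - a) \<bullet> (b - a)) / ((b - a) \<bullet> (b - a))"
  have nz: "(b - a) \<bullet> (b - a) \<noteq> 0"
    using False by simp
  obtain b1 b2 c1 c2 where bc: "b - a = (b1, b2)" "c - a = (c1, c2)"
    by fastforce
  have "b1 * c2 = b2 * c1"
    using assms by (simp add: cross_def bc)
  then have "((b - a) \<bullet> (b - a)) *\<^sub>R (c - a) = ((c - a) \<bullet> (b - a)) *\<^sub>R (b - a)"
    unfolding bc by (simp add: inner_prod_def algebra_simps)
  then have "inverse ((b - a) \<bullet> (b - a)) *\<^sub>R (((b - a) \<bullet> (b - a)) *\<^sub>R (c - a)) = k *\<^sub>R (b - a)"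
    by (simp add: k_def divide_inverse mult.commute)
  then have "c - a = k *\<^sub>R (b - a)"
    using nz by simp
  then have "c = (1 - k) *\<^sub>R a + (1 - (1 - k)) *\<^sub>R b"
    by (simp add: algebra_simps)
  then have "collinear {a, c, b}"
    unfolding collinear_3_expand by blast
  then show ?thesis
    by (simp add: insert_commute)
qed

text \<open>The function \<open>cross (b - a) (y - a)\<close> is affine along \<open>cd\<close>,
  zero at \<open>z\<close> and nonzero at \<open>d\<close>. It has no other zero there, so the two
  segments share only \<open>z\<close>.\<close>

lemma proper_crossI:
  assumes ab: "z = (1 - s) *\<^sub>R a + s *\<^sub>R b" "0 < s" "s < 1"
    and cd: "z = (1 - t) *\<^sub>R c + t *\<^sub>R d" "0 < t" "t < 1"
    and nz: "cross (b - a) (d - a) \<noteq> 0"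
  shows "proper_cross a b c d"
proof -
  define f where "f y = cross (b - a) (y - a)" for y
  have f_aff: "f ((1 - t) *\<^sub>R y + t *\<^sub>R y') = (1 - t) * f y + t * f y'" for t y y'
    by (simp add: f_def cross_def algebra_simps)
  have f0: "f ((1 - s) *\<^sub>R a + s *\<^sub>R b) = 0" for s
    unfolding f_aff by (simp add: f_def cross_def)
  have fd: "f d \<noteq> 0"
    using nz by (simp add: f_def)
  have eq0: "(1 - t) * f c + t * f d = 0"
    using f0[of s] ab(1) cd(1) f_aff by metis
  have uniq: "y = z" if y: "y \<in> closed_segment a b" "y \<in> closed_segment c d" for y
  proof -
    obtain s' t' where y: "y = (1 - s') *\<^sub>R a + s' *\<^sub>R b" "y = (1 - t') *\<^sub>R c + t' *\<^sub>R d"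
      using y unfolding in_segment by blast
    then have "(1 - t') * f c + t' * f d = 0"
      using f0[of s'] f_aff by metis
    \<comment> \<open>This combination eliminates \<open>f c\<close> from the two equations.\<close>
    have "(t' - t) * f d = (1 - t) * ((1 - t') * f c + t' * f d)
        - (1 - t') * ((1 - t) * f c + t * f d)"
      by (simp add: algebra_simps)
    also have "\<dots> = 0"
      using eq0 \<open>(1 - t') * f c + t' * f d = 0\<close> by simp
    finally have "t' = t"
      using fd by simp
    with y cd show ?thesis by simp
  qed
  have "z \<noteq> d"
    using f0[of s] ab(1) fd by auto
  moreover have "z \<noteq> c"
  proof
    assume "z = c"
    then have "t *\<^sub>R (d - c) = 0"
      using cd(1) by (simp add: algebra_simps)
    with cd(2) \<open>z = c\<close> \<open>z \<noteq> d\<close> show False by simp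
  qed
  moreover have "b \<noteq> a"
    using nz by (auto simp: cross_def)
  moreover have "z \<noteq> a"
  proof
    assume "z = a"
    then have "s *\<^sub>R (b - a) = 0"
      using ab(1) by (simp add: algebra_simps)
    with ab(2) \<open>b \<noteq> a\<close> show False by simp
  qed
  moreover have "z \<noteq> b"
  proof
    assume "z = b"
    moreover have "b - z = (1 - s) *\<^sub>R (b - a)"
      using ab(1) by (simp add: algebra_simps)
    ultimately show False
      using ab(3) \<open>b \<noteq> a\<close> by simp
  qed
  moreover have "z \<in> closed_segment a b" "z \<in> closed_segment c d"
    using ab cd by (auto simp: in_segment intro: less_imp_le)
  ultimately show ?thesis
    unfolding proper_cross_def using uniq by blast
qed

lemma proper_crossE:
  assumes "proper_cross a b c d"
  obtains z s t where "z = (1 - s) *\<^sub>R a + s *\<^sub>R b" "0 < s" "s < 1"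
    "z = (1 - t) *\<^sub>R c + t *\<^sub>R d" "0 < t" "t < 1" "z \<notin> {a, b, c, d}"
proof -
  obtain z where z: "z \<in> closed_segment a b" "z \<in> closed_segment c d" "z \<notin> {a, b, c, d}"
    using assms unfolding proper_cross_def by blast
  then obtain s t where st: "z = (1 - s) *\<^sub>R a + s *\<^sub>R b" "0 \<le> s" "s \<le> 1"
    "z = (1 - t) *\<^sub>R c + t *\<^sub>R d" "0 \<le> t" "t \<le> 1"
    unfolding in_segment by blast
  then have "s \<noteq> 0" "s \<noteq> 1" "t \<noteq> 0" "t \<noteq> 1"
    using z(3) by auto
  with st z(3) that[of z s t] show ?thesis by simp
qed

lemma proper_cross_endpoints:
  assumes "proper_cross a b c d"
  shows "{a, b} \<inter> {c, d} = {}"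
proof -
  obtain q where q: "closed_segment a b \<inter> closed_segment c d = {q}" "q \<notin> {a, b, c, d}"
    using assms unfolding proper_cross_def by blast
  have "{a, b} \<inter> {c, d} \<subseteq> closed_segment a b \<inter> closed_segment c d"
    by auto
  then have "{a, b} \<inter> {c, d} \<subseteq> {q}"
    by (simp only: q(1))
  with q(2) show ?thesis
    by auto
qed

lemma proper_cross_commute: "proper_cross b a c d \<longleftrightarrow> proper_cross a b c d"
  by (auto simp: proper_cross_def closed_segment_commute insert_commute)

lemma visible_commute: "visible S u v \<longleftrightarrow> visible S v u"
  unfolding visible_def by (metis insert_commute proper_cross_commute)

lemma visible_not_cross:
  assumes "constraints P S" "visible S u v" "{c, d} \<in> S"
  shows "\<not> proper_cross u v c d"
proof (cases "{u, v} \<in> S")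
  case True
  have "\<forall>s\<in>S. \<forall>s'\<in>S. \<forall>a b c d. s = {a, b} \<longrightarrow> s' = {c, d} \<longrightarrow> \<not> proper_cross a b c d"
    using assms(1) by (simp add: constraints_def)
  from this[rule_format, OF True assms(3) refl refl] show ?thesis .
next
  case False
  with assms(2) have "\<forall>s\<in>S. \<forall>c d. s = {c, d} \<longrightarrow> \<not> proper_cross u v c d"
    unfolding visible_def by blast
  from this[rule_format, OF assms(3) refl] show ?thesis .
qed

lemma visible_I:
  assumes "\<And>c d. {c, d} \<in> S \<Longrightarrow> \<not> proper_cross u v c d"
  shows "visible S u v"
  using assms unfolding visible_def by blast

lemma affine_at_ratio:
  fixes D :: real
  assumes "D \<noteq> 0"
  shows "(1 - k / D) * y + k / D * y' = (D * y + k * (y' - y)) / D"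
  using assms by (simp add: field_simps)

text \<open>The function that vanishes first supplies \<open>\<tau>\<close>. If both end negative,
  the zeros \<open>f0 / (f0 - f1)\<close> and \<open>g0 / (g0 - g1)\<close> are ordered by comparing
  \<open>f0 * g1\<close> with \<open>g0 * f1\<close>.\<close>

lemma affine_first_exit:
  fixes f0 f1 g0 g1 :: real
  assumes "f0 > 0" "g0 > 0" "f1 < 0 \<or> g1 < 0"
  obtains \<tau> where "0 < \<tau>" "\<tau> < 1"
    "f1 < 0 \<and> (1 - \<tau>) * f0 + \<tau> * f1 = 0 \<and> (1 - \<tau>) * g0 + \<tau> * g1 \<ge> 0 \<or>
     g1 < 0 \<and> (1 - \<tau>) * g0 + \<tau> * g1 = 0 \<and> (1 - \<tau>) * f0 + \<tau> * f1 \<ge> 0"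
proof (cases "f1 < 0 \<and> f0 * g1 \<ge> g0 * f1")
  case True
  define \<tau> where "\<tau> = f0 / (f0 - f1)"
  have f: "f0 - f1 > 0"
    using True assms by linarith
  have eq: "(1 - \<tau>) * y + \<tau> * y' = ((f0 - f1) * y + f0 * (y' - y)) / (f0 - f1)" for y y'
    unfolding \<tau>_def by (rule affine_at_ratio) (use f in simp)
  have "(1 - \<tau>) * f0 + \<tau> * f1 = 0" "(1 - \<tau>) * g0 + \<tau> * g1 = (f0 * g1 - g0 * f1) / (f0 - f1)"
    unfolding eq by (simp_all add: algebra_simps)
  moreover have "0 < \<tau>" "\<tau> < 1"
    using f True assms by (simp_all add: \<tau>_def divide_simps)
  ultimately show ?thesis
    using that[of \<tau>] True f by simp
next
  case False
  have "g1 < 0 \<and> f0 * g1 \<le> g0 * f1"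
  proof (cases "f1 < 0")
    case True
    then have *: "f0 * g1 < g0 * f1"
      using False by simp
    also have "\<dots> < 0"
      using True assms(2) by (simp add: mult_pos_neg)
    finally have "g1 < 0"
      using assms(1) by (simp add: mult_less_0_iff)
    with * show ?thesis by simp
  next
    case f1: False
    then have "g1 < 0"
      using assms(3) by simp
    then have "f0 * g1 < 0" "0 \<le> g0 * f1"
      using assms f1 by (auto simp: mult_pos_neg)
    with \<open>g1 < 0\<close> show ?thesis by linarith
  qed
  then have g1: "g1 < 0" and le: "f0 * g1 \<le> g0 * f1"
    by auto
  define \<tau> where "\<tau> = g0 / (g0 - g1)"
  have g: "g0 - g1 > 0"
    using g1 assms by linarith
  have eq: "(1 - \<tau>) * y + \<tau> * y' = ((g0 - g1) * y + g0 * (y' - y)) / (g0 - g1)" for y y'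
    unfolding \<tau>_def by (rule affine_at_ratio) (use g in simp)
  have "(1 - \<tau>) * g0 + \<tau> * g1 = 0" "(1 - \<tau>) * f0 + \<tau> * f1 = (g0 * f1 - f0 * g1) / (g0 - g1)"
    unfolding eq by (simp_all add: algebra_simps)
  moreover have "0 < \<tau>" "\<tau> < 1"
    using g g1 assms by (simp_all add: \<tau>_def divide_simps)
  ultimately show ?thesis
    using that[of \<tau>] g1 le g by simp
qed

section \<open>Affine coordinates at a vertex\<close>

locale frame =
  fixes u e1 e2 :: pt
  assumes indep: "cross e1 e2 \<noteq> 0"
begin

text \<open>Cramer's rule for the coordinates of \<open>y - u\<close> in the basis
  \<open>e1\<close>, \<open>e2\<close>.\<close>

definition X :: "pt \<Rightarrow> real" where
  "X y = cross (y - u) e2 / cross e1 e2"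

definition Y :: "pt \<Rightarrow> real" where
  "Y y = cross e1 (y - u) / cross e1 e2"

text \<open>This is \<open>cross\<close> measured relative to \<open>cross e1 e2\<close>, so both
  mirror images of a configuration get the same signs.\<close>

definition det :: "pt \<Rightarrow> pt \<Rightarrow> real" where
  "det a y = X a * Y y - Y a * X y"

lemma X_u [simp]: "X u = 0" and Y_u [simp]: "Y u = 0"
  by (simp_all add: X_def Y_def cross_def)

lemma X_affine: "X ((1 - t) *\<^sub>R a + t *\<^sub>R b) = (1 - t) * X a + t * X b"
proof -
  have "cross ((1 - t) *\<^sub>R a + t *\<^sub>R b - u) e2 = (1 - t) * cross (a - u) e2 + t * cross (b - u) e2"
    by (simp add: cross_def algebra_simps)
  then show ?thesis
    by (simp add: X_def add_divide_distrib)
qed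

lemma Y_affine: "Y ((1 - t) *\<^sub>R a + t *\<^sub>R b) = (1 - t) * Y a + t * Y b"
proof -
  have "cross e1 ((1 - t) *\<^sub>R a + t *\<^sub>R b - u) = (1 - t) * cross e1 (a - u) + t * cross e1 (b - u)"
    by (simp add: cross_def algebra_simps)
  then show ?thesis
    by (simp add: Y_def add_divide_distrib)
qed

lemma det_affine: "det a ((1 - t) *\<^sub>R b + t *\<^sub>R c) = (1 - t) * det a b + t * det a c"
  unfolding det_def X_affine Y_affine by (simp add: algebra_simps)

lemma det_u [simp]: "det a u = 0" and det_self [simp]: "det a a = 0"
  by (simp_all add: det_def)

lemma expand: "y - u = X y *\<^sub>R e1 + Y y *\<^sub>R e2"
proof -
  have "cross e1 e2 *\<^sub>R (y - u) = cross (y - u) e2 *\<^sub>R e1 + cross e1 (y - u) *\<^sub>R e2"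
    by (simp add: cross_def prod_eq_iff algebra_simps)
  then have "inverse (cross e1 e2) *\<^sub>R (cross e1 e2 *\<^sub>R (y - u)) =
      inverse (cross e1 e2) *\<^sub>R (cross (y - u) e2 *\<^sub>R e1 + cross e1 (y - u) *\<^sub>R e2)"
    by simp
  then show ?thesis
    using indep by (simp add: X_def Y_def divide_inverse scaleR_add_right mult.commute)
qed

lemma coords_eqI: "X a = X b \<Longrightarrow> Y a = Y b \<Longrightarrow> a = b"
  using expand[of a] expand[of b] by (metis diff_add_cancel)

lemma diff_expand: "b - a = (X b - X a) *\<^sub>R e1 + (Y b - Y a) *\<^sub>R e2"
proof -
  have "b - a = (b - u) - (a - u)"
    by simp
  also have "\<dots> = (X b - X a) *\<^sub>R e1 + (Y b - Y a) *\<^sub>R e2"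
    unfolding expand[of a] expand[of b] by (simp add: algebra_simps)
  finally show ?thesis .
qed

lemma cross_det: "cross (a - u) (b - u) = det a b * cross e1 e2"
  by (simp only: expand cross_combination det_def)

lemma cross_coords:
  "cross (b - a) (c - a) = ((X b - X a) * (Y c - Y a) - (Y b - Y a) * (X c - X a)) * cross e1 e2"
  by (simp only: diff_expand[of _ a] cross_combination)

end

section \<open>Gift wrapping inside a wedge free of constraints at its apex\<close>

text \<open>The point \<open>w\<close> lies on the positive \<open>e2\<close> axis. For
  \<open>X v > 0\<close>, the conditions \<open>X y \<ge> 0\<close> and \<open>det v y > 0\<close>
  describe the wedge at \<open>u\<close> from the ray \<open>uv\<close> (excluded) to the ray
  \<open>uw\<close> (included).\<close>

locale wedge = frame +
  fixes P :: "pt set" and S :: "pt set set" and w :: pt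
  assumes fin: "finite P" and constr: "constraints P S"
    and gen: "\<And>a b c. a \<in> P \<Longrightarrow> b \<in> P \<Longrightarrow> c \<in> P \<Longrightarrow> a \<noteq> b \<Longrightarrow> a \<noteq> c \<Longrightarrow> b \<noteq> c \<Longrightarrow>
      \<not> collinear {a, b, c}"
    and uP: "u \<in> P" and wP: "w \<in> P" and Xw: "X w = 0" and Yw: "Y w > 0"
    and vis_uw: "visible S u w"
begin

lemma constraint_ends: "{c, d} \<in> S \<Longrightarrow> c \<in> P \<and> d \<in> P \<and> c \<noteq> d"
  using constr unfolding constraints_def by (metis doubleton_eq_iff)

lemma det_nonzero: "a \<in> P \<Longrightarrow> b \<in> P \<Longrightarrow> a \<noteq> u \<Longrightarrow> b \<noteq> u \<Longrightarrow> a \<noteq> b \<Longrightarrow> det a b \<noteq> 0"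
  using gen[of u a b] uP collinear_of_cross[of a u b] cross_det[of a b] by auto

lemma X_pos: "y \<in> P \<Longrightarrow> y \<noteq> u \<Longrightarrow> y \<noteq> w \<Longrightarrow> X y \<ge> 0 \<Longrightarrow> X y > 0"
  using det_nonzero[of w y] wP Xw Yw by (fastforce simp: det_def)

text \<open>Positive on the side of the line through \<open>v\<close> and \<open>p\<close> that contains \<open>u\<close>, if \<open>X v\<close> and
  \<open>det v p\<close> are positive.\<close>
definition side :: "pt \<Rightarrow> pt \<Rightarrow> pt \<Rightarrow> real" where
  "side v p y = (X v - X y) * det v p - (X v - X p) * det v y"

lemma side_affine: "side v p ((1 - t) *\<^sub>R b + t *\<^sub>R c) = (1 - t) * side v p b + t * side v p c"
  unfolding side_def X_affine det_affine by (simp add: algebra_simps)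

lemma side_self [simp]: "side v p v = 0" "side v p p = 0"
  by (simp_all add: side_def)

lemma side_u [simp]: "side v p u = X v * det v p"
  by (simp add: side_def)

text \<open>A constraint through the wedge has one endpoint beyond the line \<open>vp\<close> on the side of \<open>u\<close>;
  on the way to that endpoint it must leave the wedge through the segment \<open>uv\<close> or \<open>uw\<close>.\<close>
lemma no_escape:
  assumes v: "v \<in> P" "X v > 0" "visible S u v"
    and p: "det v p > 0" "X p < X v" "det v p \<le> (X v - X p) * Y w"
    and cd: "{c, d} \<in> S" "c \<noteq> u" "d \<noteq> u"
    and r: "r = (1 - t) *\<^sub>R c + t *\<^sub>R d" "0 < t" "t < 1"
      "X r > 0" "det v r > 0" "side v p r \<ge> 0"
    and d: "side v p d > 0" "X d < 0 \<or> det v d < 0"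
  shows False
proof -
  obtain \<tau> where \<tau>: "0 < \<tau>" "\<tau> < 1" and
    disj: "X d < 0 \<and> (1 - \<tau>) * X r + \<tau> * X d = 0 \<and> (1 - \<tau>) * det v r + \<tau> * det v d \<ge> 0 \<or>
     det v d < 0 \<and> (1 - \<tau>) * det v r + \<tau> * det v d = 0 \<and> (1 - \<tau>) * X r + \<tau> * X d \<ge> 0"
    using affine_first_exit[OF r(4,5) d(2)] by blast
  define z where "z = (1 - \<tau>) *\<^sub>R r + \<tau> *\<^sub>R d"
  \<comment> \<open>The parameter of \<open>z\<close> on \<open>cd\<close>: the coefficient of
    \<open>c\<close> is the product of the two coefficients.\<close>
  define t' where "t' = 1 - (1 - \<tau>) * (1 - t)"
  have zt: "z = (1 - t') *\<^sub>R c + t' *\<^sub>R d"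
    unfolding z_def t'_def r(1) by (simp add: algebra_simps)
  have "0 < (1 - \<tau>) * (1 - t)" "(1 - \<tau>) * (1 - t) < 1 * 1"
    using \<tau> r(2,3) by (simp, intro mult_strict_mono) auto
  then have t': "0 < t'" "t' < 1"
    by (auto simp: t'_def)
  have cdP: "c \<in> P" "d \<in> P" "c \<noteq> d"
    using constraint_ends cd(1) by auto
  have "z \<noteq> u"
  proof
    assume "z = u"
    then have "u = (1 - t') *\<^sub>R c + t' *\<^sub>R d"
      using zt by simp
    then have "u = (1 - t') *\<^sub>R c + (1 - (1 - t')) *\<^sub>R d"
      by simp
    then have "collinear {c, u, d}"
      unfolding collinear_3_expand by blast
    then show False
      using gen[of c u d] cdP cd uP by auto
  qed
  \<comment> \<open>Since \<open>v\<close> lies on the line \<open>vp\<close> and \<open>w\<close>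
    on or beyond it, this keeps \<open>z\<close> before the far end of the segment \<open>uv\<close>
    or \<open>uw\<close> whose ray it meets.\<close>
  have sz: "side v p z > 0"
    unfolding z_def side_affine using \<tau> r(6) d(1) by (simp add: add_nonneg_pos)
  from disj show False
  proof
    assume *: "X d < 0 \<and> (1 - \<tau>) * X r + \<tau> * X d = 0 \<and> (1 - \<tau>) * det v r + \<tau> * det v d \<ge> 0"
    then have Xz: "X z = 0" and "det v z \<ge> 0"
      by (auto simp: z_def X_affine det_affine)
    then have Yz: "Y z > 0"
      using v(2) \<open>z \<noteq> u\<close> coords_eqI[of z u]
      by (auto simp: det_def zero_le_mult_iff less_le)
    have "X v * ((X v - X p) * Y z) < X v * det v p"
      using sz Xz by (simp add: side_def det_def algebra_simps)
    then have "(X v - X p) * Y z < (X v - X p) * Y w"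
      using v(2) p(3) by simp
    then have "Y z < Y w"
      using p(2) by simp
    define s where "s = Y z / Y w"
    have s: "0 < s" "s < 1"
      using Yz Yw \<open>Y z < Y w\<close> by (auto simp: s_def)
    have "z = (1 - s) *\<^sub>R u + s *\<^sub>R w"
      by (rule coords_eqI) (use Yw in \<open>simp_all add: X_affine Y_affine Xz Xw s_def\<close>)
    moreover have "cross (w - u) (d - u) \<noteq> 0"
      using * Yw Xw indep by (simp add: cross_det det_def)
    ultimately have "proper_cross u w c d"
      using proper_crossI s zt t' by blast
    with visible_not_cross[OF constr vis_uw cd(1)] show False by simp
  next
    assume *: "det v d < 0 \<and> (1 - \<tau>) * det v r + \<tau> * det v d = 0 \<and> (1 - \<tau>) * X r + \<tau> * X d \<ge> 0"
    then have dz: "det v z = 0" and "X z \<ge> 0"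
      by (auto simp: z_def X_affine det_affine)
    have YX: "Y z = X z / X v * Y v"
      using dz v(2) by (simp add: det_def field_simps)
    have "X z > 0"
      using \<open>X z \<ge> 0\<close> YX \<open>z \<noteq> u\<close> coords_eqI[of z u] by (auto simp: less_le)
    have "X z < X v"
      using sz dz p(1) by (simp add: side_def zero_less_mult_iff)
    define s where "s = X z / X v"
    have s: "0 < s" "s < 1"
      using \<open>X z > 0\<close> \<open>X z < X v\<close> by (auto simp: s_def)
    have "z = (1 - s) *\<^sub>R u + s *\<^sub>R v"
      by (rule coords_eqI) (use v(2) YX in \<open>simp_all add: X_affine Y_affine s_def\<close>)
    moreover have "cross (v - u) (d - u) \<noteq> 0"
      using * indep by (simp add: cross_det)
    ultimately have "proper_cross u v c d"
      using proper_crossI s zt t' by blast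
    with visible_not_cross[OF constr v(3) cd(1)] show False by simp
  qed
qed

text \<open>The vertex \<open>p\<close> is the first one of the wedge met by the ray
  \<open>vu\<close> as it turns about \<open>v\<close>. A constraint blocking \<open>up\<close> or
  \<open>vp\<close> would have an end strictly on the side of \<open>u\<close> of the line
  \<open>vp\<close>; that end is outside the wedge, and \<open>no_escape\<close> applies.\<close>

lemma wrap_step:
  assumes v: "v \<in> P" "X v > 0" "visible S u v"
    and empty: "\<And>y. {u, y} \<in> S \<Longrightarrow> X y > 0 \<Longrightarrow> \<not> det v y > 0"
  obtains p where "p \<in> P" "X p \<ge> 0" "X p < X v" "det v p > 0" "visible S u p" "visible S v p"
    "\<And>y. y \<in> P \<Longrightarrow> X y \<ge> 0 \<Longrightarrow> det v y > 0 \<Longrightarrow> side v p y \<le> 0"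
proof -
  define Q where "Q = {y \<in> P. X y \<ge> 0 \<and> det v y > 0}"
  \<comment> \<open>Decreasing in the angle at \<open>v\<close> measured from \<open>vu\<close>; on
    \<open>Q\<close>, the condition \<open>\<rho> y \<le> \<rho> p\<close> is equivalent to
    \<open>side v p y \<le> 0\<close>.\<close>
  define \<rho> where "\<rho> y = (X v - X y) / det v y" for y
  have "w \<in> Q"
    using wP Xw Yw v(2) by (simp add: Q_def det_def)
  have finQ: "finite (\<rho> ` Q)"
    using fin by (simp add: Q_def)
  moreover have "\<rho> ` Q \<noteq> {}"
    using \<open>w \<in> Q\<close> by blast
  ultimately have "Max (\<rho> ` Q) \<in> \<rho> ` Q"
    by (rule Max_in)
  then obtain p where p: "p \<in> Q" "Max (\<rho> ` Q) = \<rho> p"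
    by blast
  then have pmax: "\<rho> y \<le> \<rho> p" if "y \<in> Q" for y
    using Max_ge[OF finQ] that by fastforce
  have pQ: "p \<in> P" "X p \<ge> 0" "det v p > 0"
    using p(1) by (auto simp: Q_def)
  have "p \<noteq> u" "p \<noteq> v"
    using pQ(3) by auto
  have "u \<noteq> v"
    using v(2) X_u by (metis order.irrefl)
  have side: "side v p y \<le> 0" if "y \<in> P" "X y \<ge> 0" "det v y > 0" for y
    using pmax[of y] that pQ by (simp add: Q_def \<rho>_def side_def field_simps)
  \<comment> \<open>The candidate \<open>w\<close> is not on the side of \<open>u\<close>; the
    inequality is this fact divided by \<open>X v\<close>.\<close>
  have wle: "det v p \<le> (X v - X p) * Y w"
  proof -
    have "X v * det v p \<le> X v * ((X v - X p) * Y w)"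
      using side[of w] wP Xw Yw v(2) by (simp add: side_def det_def algebra_simps)
    then show ?thesis
      using v(2) by simp
  qed
  then have "0 < (X v - X p) * Y w"
    using pQ by linarith
  then have Xp: "X p < X v"
    using Yw by (simp add: zero_less_mult_iff)
  text \<open>The triangle cut off by the line \<open>vp\<close> contains no further vertex.\<close>
  have out: "X d < 0 \<or> det v d < 0" if "d \<in> P" "d \<noteq> u" "side v p d > 0" for d
  proof (rule ccontr)
    assume "\<not> (X d < 0 \<or> det v d < 0)"
    then have "X d \<ge> 0" "det v d \<ge> 0" by auto
    moreover have "d \<noteq> v"
      using that by auto
    then have "det v d \<noteq> 0"
      using det_nonzero[of v d] v that \<open>u \<noteq> v\<close> by auto
    ultimately show False
      using side[of d] that by linarith
  qed
  have vis_up: "visible S u p"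
  proof (cases "p = w")
    case True
    then show ?thesis using vis_uw by simp
  next
    case False
    then have "X p > 0"
      using X_pos pQ \<open>p \<noteq> u\<close> by blast
    show ?thesis
    proof (rule visible_I, rule notI)
      fix c d
      assume cd: "{c, d} \<in> S" "proper_cross u p c d"
      obtain z s t where z: "z = (1 - s) *\<^sub>R u + s *\<^sub>R p" "0 < s" "s < 1"
        "z = (1 - t) *\<^sub>R c + t *\<^sub>R d" "0 < t" "t < 1" "z \<notin> {u, p, c, d}"
        by (rule proper_crossE[OF cd(2)])
      have cdP: "c \<in> P" "d \<in> P" "c \<noteq> d"
        using constraint_ends cd by auto
      have nu: "u \<notin> {c, d}"
        using proper_cross_endpoints[OF cd(2)] by blast
      have zpos: "X z > 0" "det v z > 0" "side v p z > 0"
        unfolding z(1) X_affine det_affine side_affine using z(2,3) \<open>X p > 0\<close> pQ(3) v(2) by simp_all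
      \<comment> \<open>Stated for generic ends so that it serves either end of the
        constraint.\<close>
      have False if *: "{c, d} \<in> S" "z = (1 - t) *\<^sub>R c + t *\<^sub>R d" "0 < t" "t < 1" "c \<noteq> u" "d \<noteq> u"
        "side v p d > 0" for c d t
        using no_escape[OF v pQ(3) Xp wle *(1,5,6,2,3,4) zpos(1,2) less_imp_le[OF zpos(3)] *(7)]
          out[of d] * constraint_ends by blast
      note esc = this
      have "side v p c > 0 \<or> side v p d > 0"
      proof (rule ccontr)
        assume "\<not> ?thesis"
        then have "(1 - t) * side v p c + t * side v p d \<le> 0"
          using z(5,6) by (intro add_nonpos_nonpos mult_nonneg_nonpos) auto
        with zpos(3) show False
          unfolding z(4) side_affine by simp
      qed
      then show False
      proof
        assume "side v p d > 0"
        then show False using esc[of c d t] cd z nu by auto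
      next
        assume "side v p c > 0"
        then show False
          using esc[of d c "1 - t"] cd z nu by (auto simp: insert_commute add.commute)
      qed
    qed
  qed
  have vis_vp: "visible S v p"
  proof (rule visible_I, rule notI)
    fix c d
    assume cd: "{c, d} \<in> S" "proper_cross v p c d"
    obtain z s t where z: "z = (1 - s) *\<^sub>R v + s *\<^sub>R p" "0 < s" "s < 1"
      "z = (1 - t) *\<^sub>R c + t *\<^sub>R d" "0 < t" "t < 1" "z \<notin> {v, p, c, d}"
      by (rule proper_crossE[OF cd(2)])
    have cdP: "c \<in> P" "d \<in> P" "c \<noteq> d"
      using constraint_ends cd by auto
    have zpos: "X z > 0" "det v z > 0" "side v p z = 0"
      unfolding z(1) X_affine det_affine side_affine using z(2,3) pQ(2,3) v(2)
      by (simp_all add: add_pos_nonneg)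
    have False if *: "{c, d} \<in> S" "z = (1 - t) *\<^sub>R c + t *\<^sub>R d" "0 < t" "t < 1"
      "side v p d > 0" for c d t
    proof -
      have "(1 - t) * side v p c + t * side v p d = 0"
        using zpos(3) unfolding *(2) side_affine .
      moreover have "t * side v p d > 0" using * by simp
      ultimately have "(1 - t) * side v p c < 0"
        by linarith
      then have "side v p c < 0"
        using *(4) by (simp add: mult_less_0_iff)
      moreover have "side v p u > 0"
        using v(2) pQ(3) by simp
      ultimately have "c \<noteq> u"
        by auto
      \<comment> \<open>Unlike \<open>up\<close>, the segment \<open>vp\<close> could be crossed by
        a constraint ending at \<open>u\<close>. Its other end would be in the open wedge, which
        \<open>empty\<close> forbids.\<close>
      moreover have "d \<noteq> u"
      proof
        assume "d = u"
        then have "X z = (1 - t) * X c" "det v z = (1 - t) * det v c"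
          unfolding *(2) X_affine det_affine by simp_all
        then have "X c > 0" "det v c > 0"
          using zpos *(4) by (auto simp: zero_less_mult_iff)
        with empty[of c] *(1) \<open>d = u\<close> show False
          by (simp add: insert_commute)
      qed
      ultimately show False
        using no_escape[OF v pQ(3) Xp wle *(1) _ _ *(2,3,4) zpos(1,2) _ *(5)] zpos(3)
          out[of d] * constraint_ends by (metis order_refl)
    qed
    note esc = this
    \<comment> \<open>Otherwise both ends lie on the line \<open>vp\<close>, against general
      position.\<close>
    have "side v p c > 0 \<or> side v p d > 0"
    proof (rule ccontr)
      assume "\<not> ?thesis"
      then have "(1 - t) * side v p c \<le> 0" "t * side v p d \<le> 0"
        using z(5,6) by (auto intro: mult_nonneg_nonpos)
      moreover have "(1 - t) * side v p c + t * side v p d = 0"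
        using zpos(3) unfolding z(4) side_affine .
      ultimately have "side v p d = 0" "side v p c = 0"
        using z(5,6) by (smt (verit) mult_eq_0_iff)+
      then have col: "cross (p - v) (y - v) = 0" if "y \<in> {c, d}" for y
      proof -
        have "X v * ((X p - X v) * (Y y - Y v) - (Y p - Y v) * (X y - X v)) = side v p y"
          by (simp add: side_def det_def algebra_simps)
        with \<open>side v p d = 0\<close> \<open>side v p c = 0\<close> that v(2) show ?thesis
          by (auto simp: cross_coords)
      qed
      have "c \<notin> {v, p}"
        using proper_cross_endpoints[OF cd(2)] by auto
      then show False
        using collinear_of_cross[OF col] gen[of v p c] v(1) pQ(1) cdP(1) \<open>p \<noteq> v\<close> by auto
    qed
    then show False
    proof
      assume "side v p d > 0"
      then show False using esc[of c d t] cd z by auto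
    next
      assume "side v p c > 0"
      then show False
        using esc[of d c "1 - t"] cd z by (auto simp: insert_commute add.commute)
    qed
  qed
  show thesis
    by (rule that[OF pQ(1,2) Xp pQ(3) vis_up vis_vp side])
qed

text \<open>Along the chain \<open>X\<close> decreases and \<open>Y\<close> does not decrease. As
  the basis vectors are unit vectors, each edge is at most the change of \<open>X\<close> plus that
  of \<open>Y\<close>, and these telescope. \<open>H\<close> is the outer induction hypothesis; the
  total being below \<open>R\<close> makes it apply to every chain edge.\<close>

lemma wedge_path:
  assumes "v \<in> P" "X v > 0" "visible S u v"
    and "\<And>y. {u, y} \<in> S \<Longrightarrow> X y > 0 \<Longrightarrow> \<not> det v y > 0"
    and "\<And>y. y \<in> P \<Longrightarrow> visible S u y \<Longrightarrow> X y \<ge> 0 \<Longrightarrow> X y \<le> X v \<Longrightarrow> det v y > 0 \<Longrightarrow> Y v \<le> Y y"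
    and "norm e1 = 1" "norm e2 = 1" "c \<ge> 0"
    and H: "\<And>a b. a \<in> P \<Longrightarrow> b \<in> P \<Longrightarrow> a \<noteq> b \<Longrightarrow> visible S a b \<Longrightarrow> dist a b < R \<Longrightarrow>
      conn E a b (c * dist a b)"
    and "X v + Y w - Y v < R"
  shows "conn E v w (c * (X v + Y w - Y v))"
  using assms(1-5,10)
proof (induction "card {y \<in> P. X y \<ge> 0 \<and> det v y > 0}" arbitrary: v rule: less_induct)
  case less
  obtain p where p: "p \<in> P" "X p \<ge> 0" "X p < X v" "det v p > 0" "visible S u p" "visible S v p"
    and side: "\<And>y. y \<in> P \<Longrightarrow> X y \<ge> 0 \<Longrightarrow> det v y > 0 \<Longrightarrow> side v p y \<le> 0"
    using wrap_step[OF less.prems(1-4)] by blast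
  have "p \<noteq> v" using p by auto
  have Yp: "Y v \<le> Y p"
    using less.prems(5) p by auto
  have Yvw: "Y v \<le> Y w"
    using less.prems(2,5) wP vis_uw Xw Yw by (simp add: det_def)
  \<comment> \<open>As \<open>w\<close> is not on the side of \<open>u\<close>, the line
    \<open>vp\<close> reaches \<open>X = 0\<close> at height at most \<open>Y w\<close>, and it does
    not fall on the way from \<open>v\<close>.\<close>
  have Ypw: "Y p \<le> Y w"
  proof -
    have "X v * ((X v - X p) * Y w - det v p) \<ge> 0"
      using side[of w] wP Xw Yw less.prems(2) by (simp add: side_def det_def algebra_simps)
    then have "(X v - X p) * Y w - det v p \<ge> 0"
      using less.prems(2) by (simp add: zero_le_mult_iff)
    then have "X v * (Y w - Y p) \<ge> X p * (Y w - Y v)"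
      by (simp add: det_def algebra_simps)
    moreover have "X p * (Y w - Y v) \<ge> 0"
      using p(2) Yvw by simp
    ultimately have "X v * (Y w - Y p) \<ge> 0"
      by linarith
    then show ?thesis
      using less.prems(2) by (simp add: zero_le_mult_iff)
  qed
  have "dist v p = norm ((X p - X v) *\<^sub>R e1 + (Y p - Y v) *\<^sub>R e2)"
    using diff_expand[of p v] by (simp only: dist_norm norm_minus_commute[of v p])
  also have "\<dots> \<le> norm ((X p - X v) *\<^sub>R e1) + norm ((Y p - Y v) *\<^sub>R e2)"
    by (rule norm_triangle_ineq)
  also have "\<dots> = (X v - X p) + (Y p - Y v)"
    using assms(6,7) p(3) Yp by simp
  finally have dvp: "dist v p \<le> (X v - X p) + (Y p - Y v)" .
  then have "dist v p < R"
    using less.prems(6) p(2) Ypw by linarith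
  then have cvp: "conn E v p (c * ((X v - X p) + (Y p - Y v)))"
    using H[of v p] less.prems(1) p \<open>p \<noteq> v\<close> dvp \<open>c \<ge> 0\<close> conn_mono mult_left_mono by metis
  show ?case
  proof (cases "p = w")
    case True
    with cvp Xw show ?thesis
      by (simp add: algebra_simps)
  next
    case False
    have "p \<noteq> u" using p(4) by auto
    then have Xp: "X p > 0"
      using X_pos p False by blast
    \<comment> \<open>The wedge of \<open>p\<close> is contained in that of \<open>v\<close>, so it
      inherits the absence of constraints; it loses \<open>p\<close>, so the count drops.\<close>
    have sub: "det v y > 0" if "X y \<ge> 0" "det p y > 0" for y
    proof -
      have "X p * det v y = X v * det p y + X y * det v p"
        by (simp add: det_def algebra_simps)
      moreover have "X v * det p y > 0" "X y * det v p \<ge> 0"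
        using that p(4) less.prems(2) by auto
      ultimately show ?thesis
        using Xp by (smt (verit) mult_nonneg_nonpos)
    qed
    have "{y \<in> P. X y \<ge> 0 \<and> det p y > 0} \<subset> {y \<in> P. X y \<ge> 0 \<and> det v y > 0}"
    proof
      show "{y \<in> P. X y \<ge> 0 \<and> det p y > 0} \<subseteq> {y \<in> P. X y \<ge> 0 \<and> det v y > 0}"
        using sub by auto
      show "{y \<in> P. X y \<ge> 0 \<and> det p y > 0} \<noteq> {y \<in> P. X y \<ge> 0 \<and> det v y > 0}"
        using p by (metis (mono_tags, lifting) det_self less_irrefl mem_Collect_eq)
    qed
    then have less_card: "card {y \<in> P. X y \<ge> 0 \<and> det p y > 0} < card {y \<in> P. X y \<ge> 0 \<and> det v y > 0}"
      using fin by (intro psubset_card_mono) auto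
    \<comment> \<open>Restores the height condition for \<open>p\<close>: by gift wrapping
      \<open>y\<close> is on or beyond the line \<open>vp\<close>, which does not fall as
      \<open>X\<close> decreases.\<close>
    have low: "Y p \<le> Y y" if y: "y \<in> P" "X y \<ge> 0" "X y \<le> X p" "det p y > 0" for y
    proof -
      have "side v p y \<le> 0"
        using side sub y by simp
      moreover have "side v p y = X v * ((X v - X y) * (Y p - Y v) - (X v - X p) * (Y y - Y v))"
        by (simp add: side_def det_def algebra_simps)
      ultimately have "(X v - X y) * (Y p - Y v) \<le> (X v - X p) * (Y y - Y v)"
        using less.prems(2) by (simp add: mult_le_0_iff)
      moreover have "(X v - X p) * (Y p - Y v) \<le> (X v - X y) * (Y p - Y v)"
        using Yp y(3) by (intro mult_right_mono) auto
      ultimately have "(X v - X p) * (Y p - Y v) \<le> (X v - X p) * (Y y - Y v)"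
        by linarith
      then show ?thesis
        using p(3) by simp
    qed
    have "conn E p w (c * (X p + Y w - Y p))"
      using less.hyps[OF less_card p(1) Xp p(5)] less.prems(4,6) sub low p(3) Yp by fastforce
    from conn_trans[OF cvp this] show ?thesis
      by (simp add: algebra_simps)
  qed
qed

end

section \<open>Subcones and nearest visible vertices\<close>

text \<open>Convexity of a cone, by the triangle inequality; \<open>n \<ge> 2\<close> makes the
  cosine factor nonnegative.\<close>

lemma in_cone_combination:
  assumes "n \<ge> 2" "in_cone n i u v" "in_cone n i u w" "a \<ge> 0" "b \<ge> 0"
    and y: "y - u = a *\<^sub>R (v - u) + b *\<^sub>R (w - u)" "y \<noteq> u"
  shows "in_cone n i u y"
proof -
  have c: "cos (pi / real n) \<ge> 0"
  proof (rule cos_ge_zero)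
    show "pi / real n \<le> pi / 2"
      using assms(1) by (intro divide_left_mono) auto
    show "- (pi / 2) \<le> pi / real n"
      by (rule order_trans[of _ 0]) auto
  qed
  have "norm (y - u) * cos (pi / real n) \<le> (a * norm (v - u) + b * norm (w - u)) * cos (pi / real n)"
    using c assms(4,5) norm_triangle_ineq[of "a *\<^sub>R (v - u)" "b *\<^sub>R (w - u)"]
    unfolding y(1) by (intro mult_right_mono) auto
  also have "\<dots> = a * (norm (v - u) * cos (pi / real n)) + b * (norm (w - u) * cos (pi / real n))"
    by (simp add: algebra_simps)
  also have "\<dots> \<le> a * ((v - u) \<bullet> bisector n i) + b * ((w - u) \<bullet> bisector n i)"
    using assms(2-5) unfolding in_cone_def by (intro add_mono mult_left_mono) auto
  also have "\<dots> = (y - u) \<bullet> bisector n i"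
    unfolding y(1) by (simp add: inner_add_left)
  finally show ?thesis
    using y(2) by (simp add: in_cone_def)
qed

text \<open>Zorn's lemma applies because being unsplit concerns pairs, and two points of the union
  of a chain lie in a common member.\<close>

lemma subcone_exists:
  assumes "in_cone n i u w"
  obtains Z where "subcone n S u i Z" "w \<in> Z"
proof -
  define A where "A = {Z. w \<in> Z \<and> unsplit n S u i Z}"
  have "{w} \<in> A"
    using assms by (auto simp: A_def unsplit_def separated_def mult_less_0_iff)
  then have "A \<noteq> {}" by blast
  moreover have "\<Union>C \<in> A" if C: "C \<noteq> {}" "subset.chain A C" for C
  proof -
    have sub: "C \<subseteq> A" and chain: "\<And>a b. a \<in> C \<Longrightarrow> b \<in> C \<Longrightarrow> a \<subseteq> b \<or> b \<subseteq> a"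
      using C(2) unfolding subset_chain_def by auto
    have "w \<in> \<Union>C"
      using C(1) sub by (auto simp: A_def)
    moreover have "unsplit n S u i (\<Union>C)"
      unfolding unsplit_def
    proof (intro conjI ballI)
      show "\<Union>C \<subseteq> {z. in_cone n i u z}"
        using sub by (force simp: A_def unsplit_def)
      fix z z' assume "z \<in> \<Union>C" "z' \<in> \<Union>C"
      then obtain a where "a \<in> C" "z \<in> a" "z' \<in> a"
        using chain by blast
      then show "\<not> separated n S u i z z'"
        using sub by (force simp: A_def unsplit_def)
    qed
    ultimately show ?thesis
      by (simp add: A_def)
  qed
  ultimately obtain Z where "Z \<in> A" "\<And>Z'. Z' \<in> A \<Longrightarrow> Z \<subseteq> Z' \<Longrightarrow> Z' = Z"
    using subset_Zorn_nonempty[of A] by blast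
  then have "subcone n S u i Z" "w \<in> Z"
    unfolding subcone_def A_def by auto
  then show thesis
    by (rule that)
qed

lemma cross_combination_right:
  "cross s (a *\<^sub>R v + b *\<^sub>R w) = a * cross s v + b * cross s w"
  by (simp add: cross_def algebra_simps)

text \<open>The test \<open>cross (s - u)\<close> is linear, so a constraint separating
  \<open>y\<close> from a point of \<open>Z\<close> would separate \<open>v\<close> or
  \<open>w\<close> from it. Maximality of \<open>Z\<close> then absorbs \<open>y\<close>.\<close>

lemma subcone_combination:
  assumes "n \<ge> 2" and Z: "subcone n S u i Z" and "v \<in> Z" "w \<in> Z" "a \<ge> 0" "b \<ge> 0"
    and y: "y - u = a *\<^sub>R (v - u) + b *\<^sub>R (w - u)" "y \<noteq> u"
  shows "y \<in> Z"
proof -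
  have Zu: "unsplit n S u i Z"
    using Z by (simp add: subcone_def)
  then have "in_cone n i u v" "in_cone n i u w"
    using assms(3,4) by (auto simp: unsplit_def)
  then have cone: "in_cone n i u y"
    using in_cone_combination assms by blast
  have yz: "\<not> separated n S u i y z" if "z \<in> Z" for z
  proof
    assume "separated n S u i y z"
    then obtain s where s: "{u, s} \<in> S" "in_cone n i u s"
      and neg: "cross (s - u) (y - u) * cross (s - u) (z - u) < 0"
      by (auto simp: separated_def)
    have "cross (s - u) (v - u) * cross (s - u) (z - u) \<ge> 0"
      "cross (s - u) (w - u) * cross (s - u) (z - u) \<ge> 0"
      using Zu assms(3,4) that s unfolding unsplit_def separated_def by (meson not_less)+
    then have "a * (cross (s - u) (v - u) * cross (s - u) (z - u)) +
        b * (cross (s - u) (w - u) * cross (s - u) (z - u)) \<ge> 0"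
      using assms(5,6) by simp
    also have "a * (cross (s - u) (v - u) * cross (s - u) (z - u)) +
        b * (cross (s - u) (w - u) * cross (s - u) (z - u)) =
        cross (s - u) (y - u) * cross (s - u) (z - u)"
      unfolding y(1) cross_combination_right by (simp add: algebra_simps)
    finally show False
      using neg by simp
  qed
  have "separated n S u i z y \<longleftrightarrow> separated n S u i y z" for z
    unfolding separated_def by (simp add: mult.commute)
  then have zy: "\<not> separated n S u i z y" if "z \<in> Z" for z
    using yz that by blast
  have "\<not> separated n S u i y y"
    by (auto simp: separated_def mult_less_0_iff)
  then have "unsplit n S u i (insert y Z)"
    using Zu cone yz zy unfolding unsplit_def by (simp only: ball_simps) blast
  then have "insert y Z = Z"
    using Z unfolding subcone_def by blast
  then show ?thesis by blast
qed

lemma theta_neighbour: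
  assumes "finite P" "u \<in> P" "w \<in> P" "visible S u w" "i < n" "in_cone n i u w"
  obtains Z v where "subcone n S u i Z" "w \<in> Z" "v \<in> Z" "v \<in> P" "v \<noteq> u" "visible S u v"
    "theta_half n P S u v"
    "\<And>y. y \<in> P \<Longrightarrow> y \<in> Z \<Longrightarrow> visible S u y \<Longrightarrow>
      (v - u) \<bullet> bisector n i \<le> (y - u) \<bullet> bisector n i"
proof -
  obtain Z where Z: "subcone n S u i Z" "w \<in> Z"
    using subcone_exists[OF assms(6)] .
  define Q where "Q = {y \<in> P. y \<in> Z \<and> visible S u y}"
  define v where "v = arg_min_on (\<lambda>y. (y - u) \<bullet> bisector n i) Q"
  have "w \<in> Q"
    using assms Z unfolding Q_def by blast
  then have Q: "finite Q" "Q \<noteq> {}"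
    using assms(1) by (simp add: Q_def, blast)
  have v: "v \<in> P" "v \<in> Z" "visible S u v"
    using arg_min_if_finite(1)[OF Q] unfolding v_def Q_def by blast+
  have least: "(v - u) \<bullet> bisector n i \<le> (y - u) \<bullet> bisector n i"
    if "y \<in> P" "y \<in> Z" "visible S u y" for y
    using arg_min_least[OF Q, of y "\<lambda>y. (y - u) \<bullet> bisector n i"] that unfolding v_def Q_def by blast
  have "v \<noteq> u"
    using Z(1) v(2) by (auto simp: subcone_def unsplit_def in_cone_def)
  moreover from this have "theta_half n P S u v"
    unfolding theta_half_def using assms Z v least by blast
  ultimately show thesis
    using that Z v least by blast
qed

section \<open>The bisector nearest to a given direction\<close>

lemma inner_cone_dir: "cone_dir a \<bullet> cone_dir b = cos (a - b)"
  by (simp add: cone_dir_def inner_prod_def cos_diff)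

lemma cone_dir_add_turns: "cone_dir (a + 2 * pi * of_int q) = cone_dir a"
  by (simp add: cone_dir_def sin_add cos_add sin_int_2pin cos_int_2pin)

lemma bisector_near_even_multiple:
  assumes n: "n > 0" and "even j" "\<bar>\<phi> - of_int j * (pi / real n)\<bar> \<le> pi / (2 * real n)"
  shows "\<exists>i<n. cos (pi / (2 * real n)) \<le> cone_dir \<phi> \<bullet> bisector n i"
proof -
  obtain l where l: "j = 2 * l"
    using \<open>even j\<close> by blast
  define i where "i = nat (l mod int n)"
  have i: "int i = l mod int n"
    using n by (simp add: i_def)
  then have "of_int l = real i + real n * of_int (l div int n)"
    by (metis mod_mult_div_eq of_int_add of_int_mult of_int_of_nat_eq)
  then have "of_int j * (pi / real n) = real i * (2 * pi / real n) + 2 * pi * of_int (l div int n)"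
    using n by (simp add: l field_simps)
  then have "bisector n i = cone_dir (of_int j * (pi / real n))"
    unfolding bisector_def by (metis cone_dir_add_turns)
  moreover have "cos (pi / (2 * real n)) \<le> cos \<bar>\<phi> - of_int j * (pi / real n)\<bar>"
    using assms(3) n by (intro cos_monotone_0_pi_le) (auto simp: field_simps)
  moreover have "i < n"
    using i n by (metis of_nat_0_less_iff of_nat_less_iff pos_mod_bound)
  ultimately show ?thesis
    by (auto simp: inner_cone_dir)
qed

text \<open>For odd \<open>n\<close> the bisectors together with their opposites are all multiples of \<open>\<pi> / n\<close>.\<close>
lemma nearest_bisector:
  fixes d :: pt
  assumes "odd n"
  shows "\<exists>i<n. norm d * cos (pi / (2 * real n)) \<le> d \<bullet> bisector n i \<or>
    norm d * cos (pi / (2 * real n)) \<le> - d \<bullet> bisector n i"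
proof (cases "d = 0")
  case True
  then show ?thesis
    using assms odd_pos by auto
next
  case False
  have n: "n > 0"
    using assms odd_pos by blast
  have "(snd d / norm d)\<^sup>2 + (fst d / norm d)\<^sup>2 = 1"
    using False by (simp add: power_divide norm_prod_def add_divide_distrib[symmetric] prod_eq_iff
        add_nonneg_eq_0_iff add.commute)
  then obtain \<phi> where "snd d / norm d = cos \<phi>" "fst d / norm d = sin \<phi>"
    using sincos_total_2pi by metis
  then have "snd d = norm d * cos \<phi>" "fst d = norm d * sin \<phi>"
    using False by (simp_all add: nonzero_divide_eq_eq mult.commute)
  then have d: "d = norm d *\<^sub>R cone_dir \<phi>"
    by (simp add: cone_dir_def prod_eq_iff)
  \<comment> \<open>Rounding leaves an error of at most half of \<open>pi / n\<close>, which is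
    \<open>\<theta> / 4\<close>.\<close>
  define j where "j = round (\<phi> * real n / pi)"
  have "\<bar>of_int j - \<phi> * real n / pi\<bar> \<le> 1 / 2"
    unfolding j_def by (rule of_int_round_abs_le)
  moreover have "\<bar>\<phi> - of_int j * (pi / real n)\<bar> = \<bar>of_int j - \<phi> * real n / pi\<bar> * (pi / real n)"
  proof -
    have "\<phi> - of_int j * (pi / real n) = - ((of_int j - \<phi> * real n / pi) * (pi / real n))"
      using n by (simp add: field_simps)
    then show ?thesis
      by (simp add: abs_mult)
  qed
  ultimately have j: "\<bar>\<phi> - of_int j * (pi / real n)\<bar> \<le> pi / (2 * real n)"
    using n mult_right_mono[of _ "1 / 2" "pi / real n"] by fastforce
  show ?thesis
  proof (cases "even j")
    case True
    then obtain i where "i < n" "cos (pi / (2 * real n)) \<le> cone_dir \<phi> \<bullet> bisector n i"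
      using bisector_near_even_multiple n j by blast
    then have "norm d * cos (pi / (2 * real n)) \<le> norm d * (cone_dir \<phi> \<bullet> bisector n i)"
      by (intro mult_left_mono) auto
    with \<open>i < n\<close> show ?thesis
      using d by (metis inner_scaleR_left)
  next
    case odd: False
    \<comment> \<open>A half turn adds the odd number \<open>n\<close> to the index and makes it
      even; the bisector found is then close to \<open>- d\<close>.\<close>
    have "\<phi> + pi - of_int (j + int n) * (pi / real n) = \<phi> - of_int j * (pi / real n)"
      using n by (simp add: field_simps)
    then have "\<bar>\<phi> + pi - of_int (j + int n) * (pi / real n)\<bar> \<le> pi / (2 * real n)"
      using j by (simp only:)
    moreover have "even (j + int n)"
      using odd assms by simp
    ultimately obtain i where "i < n" "cos (pi / (2 * real n)) \<le> cone_dir (\<phi> + pi) \<bullet> bisector n i"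
      using bisector_near_even_multiple n by blast
    moreover have "cone_dir (\<phi> + pi) = - cone_dir \<phi>"
      by (simp add: cone_dir_def)
    ultimately have "norm d * cos (pi / (2 * real n)) \<le> norm d * (- cone_dir \<phi> \<bullet> bisector n i)"
      by (intro mult_left_mono) auto
    with \<open>i < n\<close> show ?thesis
      using d by (metis inner_scaleR_left scaleR_minus_right)
  qed
qed

section \<open>The spanning ratio\<close>

text \<open>The claimed spanning ratio, with \<open>\<delta> = \<theta> / 4\<close>.\<close>

definition ratio :: "real \<Rightarrow> real" where
  "ratio \<delta> = cos \<delta> / (cos (2 * \<delta>) - sin (3 * \<delta>))"

text \<open>The sine is the cosine of \<open>pi / 2 - 3 * \<delta>\<close>, which exceeds
  \<open>2 * \<delta>\<close> exactly when \<open>5 * \<delta> < pi / 2\<close>.\<close>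

lemma ratio_denominator_pos:
  assumes "0 < \<delta>" "5 * \<delta> < pi / 2"
  shows "cos (2 * \<delta>) - sin (3 * \<delta>) > 0"
proof -
  have "sin (3 * \<delta>) = cos (pi / 2 - 3 * \<delta>)"
    by (simp add: cos_sin_eq)
  also have "\<dots> < cos (2 * \<delta>)"
    using assms by (intro cos_monotone_0_pi) auto
  finally show ?thesis by simp
qed

lemma ratio_ge_1:
  assumes "0 < \<delta>" "5 * \<delta> < pi / 2"
  shows "ratio \<delta> \<ge> 1"
proof -
  have "cos (2 * \<delta>) \<le> cos \<delta>"
    using assms by (intro cos_monotone_0_pi_le) auto
  moreover have "sin (3 * \<delta>) \<ge> 0"
    using assms by (intro sin_ge_zero) auto
  ultimately show ?thesis
    using ratio_denominator_pos[OF assms] by (simp add: ratio_def)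
qed

text \<open>Here \<open>X\<close> and \<open>Y\<close> are the coordinates of a vector of length \<open>\<rho>\<close> in a cone, with respect
  to the unit normal of the bisector and a unit vector \<open>e\<close> at angle at most \<open>\<delta>\<close> from the
  bisector; \<open>s\<close> and \<open>\<gamma>\<close> are the components of \<open>e\<close>. Equality holds if the vector lies on the
  boundary of the cone and \<open>e\<close> has the extremal angle on the other side.\<close>
lemma ratio_bound:
  fixes X Y s \<gamma> \<rho> :: real
  assumes \<delta>: "0 < \<delta>" "5 * \<delta> < pi / 2"
    and s\<gamma>: "s\<^sup>2 + \<gamma>\<^sup>2 = 1" "cos \<delta> \<le> \<gamma>"
    and \<rho>: "\<rho> \<ge> 0" "\<rho>\<^sup>2 = X\<^sup>2 + 2 * X * Y * s + Y\<^sup>2" "\<rho> * cos (2 * \<delta>) \<le> Y * \<gamma>"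
  shows "\<rho> + ratio \<delta> * X \<le> ratio \<delta> * Y"
proof -
  define C1 S1 C2 S2 c where "C1 = cos \<delta>" and "S1 = sin \<delta>" and "C2 = cos (2 * \<delta>)"
    and "S2 = sin (2 * \<delta>)" and "c = ratio \<delta>"
  note defs = C1_def S1_def C2_def S2_def
  have pos: "C1 > 0" "S1 > 0" "C2 > 0" "S2 > 0"
    using \<delta> unfolding defs by (auto intro!: cos_gt_zero sin_gt_zero)
  have sq: "S1\<^sup>2 + C1\<^sup>2 = 1" "S2\<^sup>2 + C2\<^sup>2 = 1"
    unfolding defs by simp_all
  have "S1 < 1"
  proof (rule ccontr)
    assume "\<not> S1 < 1"
    then have "1 \<le> S1\<^sup>2" by simp
    moreover have "C1\<^sup>2 > 0" using pos by simp
    ultimately show False using sq by linarith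
  qed
  have c: "c \<ge> 1"
    using ratio_ge_1[OF \<delta>] by (simp add: c_def)
  have cC: "c * (C2 - (S2 * C1 + C2 * S1)) = C1"
  proof -
    have "sin (3 * \<delta>) = sin (2 * \<delta> + \<delta>)"
      by simp
    also have "\<dots> = S2 * C1 + C2 * S1"
      unfolding defs by (rule sin_add)
    finally show ?thesis
      using ratio_denominator_pos[OF \<delta>] by (simp add: c_def ratio_def defs)
  qed
  have \<gamma>: "\<gamma> > 0" "C1 \<le> \<gamma>"
    using s\<gamma>(2) pos(1) by (simp_all add: C1_def)
  define y where "y = Y * \<gamma>"
  have y: "y \<ge> 0" "\<rho> * C2 \<le> y"
    using \<rho>(1,3) pos(3) order_trans[of 0 "\<rho> * C2" y] by (simp_all add: y_def C2_def)
  have Y: "Y \<ge> 0"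
    using y(1) \<gamma>(1) by (simp add: y_def zero_le_mult_iff)
  have "C1\<^sup>2 \<le> \<gamma>\<^sup>2"
    using \<gamma> pos by (intro power_mono) auto
  then have "\<bar>s\<bar>\<^sup>2 \<le> S1\<^sup>2"
    using s\<gamma>(1) sq(1) by simp
  then have sS: "\<bar>s\<bar> \<le> S1"
    using pos(2) by (simp add: power2_le_iff_abs_le)
  \<comment> \<open>With \<open>\<gamma> = cos \<beta>\<close> and
    \<open>\<bar>s\<bar> = sin \<beta>\<close>, this is the monotonicity of
    \<open>cos \<beta> / (1 - sin \<beta>)\<close> for
    \<open>\<beta> \<le> \<delta>\<close>.\<close>
  have \<gamma>C: "\<gamma> * (1 - S1) \<le> C1 * (1 - \<bar>s\<bar>)"
  proof (rule power2_le_imp_le)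
    have g2: "\<gamma>\<^sup>2 = (1 - \<bar>s\<bar>) * (1 + \<bar>s\<bar>)" and c2: "C1\<^sup>2 = (1 - S1) * (1 + S1)"
      using s\<gamma>(1) sq(1) by (simp_all add: algebra_simps power2_eq_square)
    have "(1 + \<bar>s\<bar>) * (1 - S1) \<le> (1 + S1) * (1 - \<bar>s\<bar>)"
      using sS by (simp add: algebra_simps)
    then have "((1 - \<bar>s\<bar>) * (1 - S1)) * ((1 + \<bar>s\<bar>) * (1 - S1))
        \<le> ((1 - \<bar>s\<bar>) * (1 - S1)) * ((1 + S1) * (1 - \<bar>s\<bar>))"
      using sS \<open>S1 < 1\<close> by (intro mult_left_mono) auto
    then show "(\<gamma> * (1 - S1))\<^sup>2 \<le> (C1 * (1 - \<bar>s\<bar>))\<^sup>2"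
      unfolding power_mult_distrib g2 c2 by (simp add: power2_eq_square mult_ac)
    show "0 \<le> C1 * (1 - \<bar>s\<bar>)"
      using pos(1) sS \<open>S1 < 1\<close> by simp
  qed
  \<comment> \<open>The orthogonal components of the vector are \<open>x\<close> along the normal
    and \<open>y\<close> along the bisector; the cone condition becomes
    \<open>\<bar>x\<bar> * C2 \<le> y * S2\<close>.\<close>
  define x where "x = X + Y * s"
  have "\<rho>\<^sup>2 = x\<^sup>2 + y\<^sup>2"
  proof -
    have "x\<^sup>2 + y\<^sup>2 = X\<^sup>2 + 2 * X * Y * s + Y\<^sup>2 * (s\<^sup>2 + \<gamma>\<^sup>2)"
      by (simp add: x_def y_def power2_eq_square algebra_simps)
    then show ?thesis
      using \<rho>(2) s\<gamma>(1) by simp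
  qed
  have "(x * C2)\<^sup>2 \<le> (y * S2)\<^sup>2"
  proof -
    have "(\<rho> * C2)\<^sup>2 \<le> y\<^sup>2"
      using y \<rho>(1) pos(3) by (intro power_mono) auto
    then have "x\<^sup>2 * C2\<^sup>2 + y\<^sup>2 * C2\<^sup>2 \<le> y\<^sup>2 * (S2\<^sup>2 + C2\<^sup>2)"
      by (simp add: \<open>\<rho>\<^sup>2 = x\<^sup>2 + y\<^sup>2\<close> sq(2) power_mult_distrib distrib_right)
    then have "x\<^sup>2 * C2\<^sup>2 \<le> y\<^sup>2 * S2\<^sup>2"
      unfolding distrib_left by linarith
    then show ?thesis
      by (simp only: power_mult_distrib)
  qed
  then have xS: "x * C2 \<le> y * S2"
    using y(1) pos(4) power2_le_imp_le[of "x * C2" "y * S2"] by simp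
  have "- (s * (Y * C2)) \<le> \<bar>s\<bar> * (Y * C2)"
    using Y pos(3) mult_right_mono[of "- s" "\<bar>s\<bar>" "Y * C2"] by simp
  then have XC: "X * C2 \<le> y * S2 + \<bar>s\<bar> * (Y * C2)"
    using xS by (simp add: x_def algebra_simps)
  \<comment> \<open>The factor \<open>C1\<close> makes \<open>cC\<close>, the defining equation of
    \<open>c\<close>, applicable; what remains is \<open>\<gamma>C\<close> scaled by
    \<open>c * Y * C2\<close>.\<close>
  have "C1 * (y + c * (y * S2 + \<bar>s\<bar> * (Y * C2))) \<le> C1 * (c * Y * C2)"
  proof -
    have "c * Y * C2 * (\<gamma> * (1 - S1)) \<le> c * Y * C2 * (C1 * (1 - \<bar>s\<bar>))"
      using \<gamma>C c Y pos by (intro mult_left_mono) auto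
    moreover have "c * Y * C2 * (\<gamma> * (1 - S1)) = y * C1 + c * y * S2 * C1"
    proof -
      have "y * C1 + c * y * S2 * C1 = y * (c * (C2 - (S2 * C1 + C2 * S1))) + c * y * S2 * C1"
        by (simp only: cC)
      also have "\<dots> = c * Y * C2 * (\<gamma> * (1 - S1))"
        by (simp add: y_def algebra_simps)
      finally show ?thesis by simp
    qed
    ultimately show ?thesis
      by (simp add: algebra_simps)
  qed
  then have "y + c * (y * S2 + \<bar>s\<bar> * (Y * C2)) \<le> c * Y * C2"
    using pos(1) by simp
  moreover have "c * (X * C2) \<le> c * (y * S2 + \<bar>s\<bar> * (Y * C2))"
    using XC c by (intro mult_left_mono) auto
  ultimately have "(\<rho> + c * X) * C2 \<le> (c * Y) * C2"
    using y(2) by (simp add: algebra_simps)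
  then show ?thesis
    using pos(3) by (simp add: c_def)
qed

section \<open>Paths in the constrained theta graph\<close>

lemma theta_graph_commute: "theta_graph n P S u v \<Longrightarrow> theta_graph n P S v u"
  by (auto simp: theta_graph_def)

text \<open>Coordinates at \<open>u\<close> are chosen with \<open>e2\<close> along
  \<open>uw\<close> and \<open>e1\<close> orthogonal to the bisector. Then \<open>Y\<close> is
  proportional to the projection onto the bisector, and \<open>X v + Y w - Y v\<close> is
  \<open>|vq| + |qw|\<close>.\<close>

lemma theta_conn_step:
  assumes n: "n \<ge> 6" and fin: "finite P" and gp: "general_position n P" and constr: "constraints P S"
    and uw: "u \<in> P" "w \<in> P" "u \<noteq> w" "visible S u w"
    and i: "i < n" "norm (w - u) * cos (pi / (2 * real n)) \<le> (w - u) \<bullet> bisector n i"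
    and IH: "\<And>a b. a \<in> P \<Longrightarrow> b \<in> P \<Longrightarrow> a \<noteq> b \<Longrightarrow> visible S a b \<Longrightarrow> dist a b < dist u w \<Longrightarrow>
      conn (theta_graph n P S) a b (ratio (pi / (2 * real n)) * dist a b)"
  shows "conn (theta_graph n P S) u w (ratio (pi / (2 * real n)) * dist u w)"
proof -
  define \<delta> where "\<delta> = pi / (2 * real n)"
  have \<delta>: "0 < \<delta>" "5 * \<delta> < pi / 2" and \<delta>2: "pi / real n = 2 * \<delta>"
    using n by (auto simp: \<delta>_def field_simps)
  define c where "c = ratio \<delta>"
  have c: "c \<ge> 1"
    using ratio_ge_1[OF \<delta>] by (simp add: c_def)
  define b where "b = bisector n i"
  have nb: "(fst b)\<^sup>2 + (snd b)\<^sup>2 = 1"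
    by (simp add: b_def bisector_def cone_dir_def)
  have "cos (pi / real n) \<le> cos \<delta>"
    using \<delta> unfolding \<delta>2 by (intro cos_monotone_0_pi_le) auto
  then have "norm (w - u) * cos (pi / real n) \<le> norm (w - u) * cos \<delta>"
    by (intro mult_left_mono) auto
  then have "norm (w - u) * cos (pi / real n) \<le> (w - u) \<bullet> bisector n i"
    using i(2) unfolding \<delta>_def by (rule order_trans)
  then have cone_w: "in_cone n i u w"
    using uw(3) by (simp add: in_cone_def)
  obtain Z v where Z: "subcone n S u i Z" "w \<in> Z" "v \<in> Z"
    and v: "v \<in> P" "v \<noteq> u" "visible S u v" "theta_half n P S u v"
    and least: "\<And>y. y \<in> P \<Longrightarrow> y \<in> Z \<Longrightarrow> visible S u y \<Longrightarrow> (v - u) \<bullet> b \<le> (y - u) \<bullet> b"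
    unfolding b_def using theta_neighbour[OF fin uw(1,2,4) i(1) cone_w] by metis
  have edge: "theta_graph n P S u v"
    using v(4) by (simp add: theta_graph_def)
  have gen: "\<not> collinear {p, q, r}" if "p \<in> P" "q \<in> P" "r \<in> P" "p \<noteq> q" "p \<noteq> r" "q \<noteq> r" for p q r
    using gp that unfolding general_position_def by blast
  show ?thesis
  proof (cases "v = w")
    case True
    have "dist u w \<le> c * dist u w"
      using c mult_right_mono[of 1 c "dist u w"] by simp
    then show ?thesis
      using conn_mono[OF conn_edge[of "theta_graph n P S", OF edge]] True by (simp add: c_def \<delta>_def)
  next
    case False
    define N where "N = norm (w - u)"
    have N: "N > 0"
      using uw(3) by (simp add: N_def)
    define e2 where "e2 = (1 / N) *\<^sub>R (w - u)"
    have we2: "w - u = N *\<^sub>R e2" and ne2: "norm e2 = 1"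
      using N by (simp_all add: e2_def N_def)
    define \<gamma> where "\<gamma> = e2 \<bullet> b"
    have "N * cos \<delta> \<le> N * \<gamma>"
      using i(2) N ne2 unfolding \<gamma>_def by (simp add: \<delta>_def b_def we2)
    then have \<gamma>c: "cos \<delta> \<le> \<gamma>"
      using N by simp
    moreover have "cos \<delta> > 0"
      using \<delta> by (intro cos_gt_zero) auto
    ultimately have \<gamma>: "\<gamma> > 0"
      by linarith
    have "cross (v - u) (w - u) \<noteq> 0"
      using collinear_of_cross[of v u w] gen[of u v w] uw v False by auto
    moreover have "cross (v - u) (w - u) = N * cross (v - u) e2"
      using cross_combination_right[of "v - u" N e2 0 0] by (simp add: we2)
    ultimately have crossv: "cross (v - u) e2 \<noteq> 0"
      by auto
    \<comment> \<open>The sign records on which side of \<open>uw\<close> the point \<open>v\<close>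
      lies, so that \<open>X v > 0\<close> in both mirror cases.\<close>
    define \<sigma> where "\<sigma> = sgn (cross (v - u) e2)"
    have \<sigma>: "\<sigma> * \<sigma> = 1" "\<sigma> * cross (v - u) e2 > 0" "\<sigma> \<noteq> 0"
      using crossv by (auto simp: \<sigma>_def sgn_if)
    define e1 :: pt where "e1 = (\<sigma> * snd b, - \<sigma> * fst b)"
    have cross_e1: "cross e1 y = \<sigma> * (y \<bullet> b)" for y
      by (simp add: cross_def e1_def inner_prod_def algebra_simps)
    have D: "cross e1 e2 = \<sigma> * \<gamma>"
      by (simp add: cross_e1 \<gamma>_def)
    interpret frame u e1 e2
      by unfold_locales (use D \<sigma> \<gamma> in auto)
    have Xeq: "X y = \<sigma> * cross (y - u) e2 / \<gamma>" for y
    proof -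
      have "X y = (\<sigma> * \<sigma>) * cross (y - u) e2 / (\<sigma> * \<gamma>)"
        unfolding X_def D \<sigma>(1) by simp
      then show ?thesis
        using \<sigma>(3) by simp
    qed
    have Yeq: "Y y = (y - u) \<bullet> b / \<gamma>" for y
      unfolding Y_def cross_e1 using \<sigma>(3) by (simp add: \<gamma>_def)
    have Xw: "X w = 0"
      unfolding Xeq we2 by (simp add: cross_def)
    have YwN: "Y w = N"
      unfolding Yeq we2 using \<gamma> by (simp add: \<gamma>_def)
    have Xv: "X v > 0"
      unfolding Xeq using \<sigma>(2) \<gamma> by simp
    interpret wedge u e1 e2 P S w
      by unfold_locales (use fin constr gen uw Xw YwN N in auto)
    \<comment> \<open>Cramer's rule writes \<open>y - u\<close> as a nonnegative combination of
      \<open>v - u\<close> and \<open>w - u\<close>.\<close>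
    have inZ: "y \<in> Z" if y: "X y \<ge> 0" "det v y > 0" for y
    proof (rule subcone_combination[OF _ Z(1,3,2)])
      have "(X y / X v) *\<^sub>R (v - u) + (det v y / (X v * N)) *\<^sub>R (w - u) =
          (X y / X v * X v + det v y / (X v * N) * X w) *\<^sub>R e1 +
          (X y / X v * Y v + det v y / (X v * N) * Y w) *\<^sub>R e2"
        unfolding expand[of v] expand[of w] by (simp add: algebra_simps)
      moreover have "X y / X v * X v + det v y / (X v * N) * X w = X y"
        using Xv Xw by simp
      moreover have "X y / X v * Y v + det v y / (X v * N) * Y w = Y y"
        unfolding YwN using Xv N by (simp add: det_def field_simps)
      ultimately show "y - u = (X y / X v) *\<^sub>R (v - u) + (det v y / (X v * N)) *\<^sub>R (w - u)"
        by (simp only: expand[of y])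
    qed (use y Xv N n in auto)
    \<comment> \<open>A constraint from \<open>u\<close> into the open wedge would separate
      \<open>v\<close> from \<open>w\<close>, which share \<open>Z\<close>.\<close>
    have empty: "\<not> det v y > 0" if y: "{u, y} \<in> S" "X y > 0" for y
    proof
      assume dy: "det v y > 0"
      have "cross (y - u) (v - u) * cross (y - u) (w - u) =
          - (det v y * (X y * N) * (cross e1 e2)\<^sup>2)"
        unfolding cross_det using Xw YwN by (simp add: det_def power2_eq_square algebra_simps)
      also have "\<dots> < 0"
        using dy y(2) N indep by simp
      finally have neg: "cross (y - u) (v - u) * cross (y - u) (w - u) < 0" .
      have "y \<in> Z"
        using inZ y(2) dy by simp
      then have "in_cone n i u y"
        using Z(1) unfolding subcone_def unsplit_def by blast
      with y(1) neg have "separated n S u i v w"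
        unfolding separated_def by blast
      then show False
        using Z unfolding subcone_def unsplit_def by blast
    qed
    have low: "Y v \<le> Y y" if "y \<in> P" "visible S u y" "X y \<ge> 0" "det v y > 0" for y
      unfolding Yeq using least[of y] inZ[of y] that \<gamma> by (simp add: divide_right_mono)
    define s where "s = e1 \<bullet> e2"
    have e1e1: "e1 \<bullet> e1 = 1"
    proof -
      have "e1 \<bullet> e1 = (\<sigma> * \<sigma>) * ((fst b)\<^sup>2 + (snd b)\<^sup>2)"
        by (simp add: e1_def inner_prod_def power2_eq_square algebra_simps)
      then show ?thesis
        using \<sigma>(1) nb by simp
    qed
    then have ne1: "norm e1 = 1"
      by (simp add: norm_eq_sqrt_inner)
    have s\<gamma>: "s\<^sup>2 + \<gamma>\<^sup>2 = 1"
    proof -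
      have "s\<^sup>2 = (\<sigma> * \<sigma>) * (snd b * fst e2 - fst b * snd e2)\<^sup>2"
        by (simp add: s_def e1_def inner_prod_def power2_eq_square algebra_simps)
      then have "s\<^sup>2 + \<gamma>\<^sup>2 = ((fst e2)\<^sup>2 + (snd e2)\<^sup>2) * ((fst b)\<^sup>2 + (snd b)\<^sup>2)"
        unfolding \<sigma>(1) by (simp add: \<gamma>_def inner_prod_def power2_eq_square algebra_simps)
      also have "(fst e2)\<^sup>2 + (snd e2)\<^sup>2 = 1"
        using ne2 by (simp add: norm_prod_def)
      finally show ?thesis
        using nb by simp
    qed
    have "norm (v - u) + c * X v \<le> c * Y v"
      unfolding c_def
    proof (rule ratio_bound[OF \<delta> s\<gamma> \<gamma>c])
      have "(norm (v - u))\<^sup>2 = (X v *\<^sub>R e1 + Y v *\<^sub>R e2) \<bullet> (X v *\<^sub>R e1 + Y v *\<^sub>R e2)"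
        unfolding power2_norm_eq_inner expand[of v] ..
      also have "\<dots> = (X v)\<^sup>2 * (e1 \<bullet> e1) + 2 * X v * Y v * (e1 \<bullet> e2) + (Y v)\<^sup>2 * (e2 \<bullet> e2)"
        by (simp add: inner_add_left inner_add_right inner_commute[of e2 e1] power2_eq_square algebra_simps)
      finally show "(norm (v - u))\<^sup>2 = (X v)\<^sup>2 + 2 * X v * Y v * s + (Y v)\<^sup>2"
        using e1e1 ne2 by (simp add: s_def norm_eq_1)
      have "in_cone n i u v"
        using Z by (auto simp: subcone_def unsplit_def)
      then show "norm (v - u) * cos (2 * \<delta>) \<le> Y v * \<gamma>"
        using \<gamma> by (simp add: in_cone_def Yeq b_def \<delta>2)
    qed simp
    then have bound: "dist u v + c * (X v + Y w - Y v) \<le> c * N"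
      by (simp add: dist_norm norm_minus_commute YwN algebra_simps)
    \<comment> \<open>Positivity makes the bound strict, so the induction hypothesis covers all
      chain edges.\<close>
    have "dist u v > 0"
      using v(2) by simp
    then have "c * (X v + Y w - Y v) < c * N"
      using bound by linarith
    then have "X v + Y w - Y v < dist u w"
      using c by (simp add: N_def dist_norm norm_minus_commute)
    then have "conn (theta_graph n P S) v w (c * (X v + Y w - Y v))"
      using wedge_path[of v c "dist u w" "theta_graph n P S"] v Xv empty low ne1 ne2 c IH
      by (simp add: c_def \<delta>_def)
    from conn_Cons[of "theta_graph n P S", OF edge this] show ?thesis
      using bound conn_mono by (fastforce simp: N_def dist_norm norm_minus_commute c_def \<delta>_def)
  qed
qed

text \<open>The rank of \<open>|uw|\<close> among the finitely many distances, counted as the number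
  of closer pairs, serves as induction measure. \<open>nearest_bisector\<close> decides from which
  end the step is taken.\<close>

lemma theta_conn:
  assumes n: "n \<ge> 6" "odd n" and "finite P" "general_position n P" "constraints P S"
    and "u \<in> P" "w \<in> P" "u \<noteq> w" "visible S u w"
  shows "conn (theta_graph n P S) u w (ratio (pi / (2 * real n)) * dist u w)"
  using assms(6-9)
proof (induction "card {(a, b) \<in> P \<times> P. dist a b < dist u w}" arbitrary: u w rule: less_induct)
  case less
  have IH: "conn (theta_graph n P S) a b (ratio (pi / (2 * real n)) * dist a b)"
    if ab: "a \<in> P" "b \<in> P" "a \<noteq> b" "visible S a b" "dist a b < dist u w" for a b
  proof (rule less.hyps[OF _ ab(1-4)])
    have "(a, b) \<in> {(x, y) \<in> P \<times> P. dist x y < dist u w} - {(x, y) \<in> P \<times> P. dist x y < dist a b}"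
      using ab by auto
    moreover have "{(x, y) \<in> P \<times> P. dist x y < dist a b} \<subseteq> {(x, y) \<in> P \<times> P. dist x y < dist u w}"
      using ab(5) by auto
    ultimately have "{(x, y) \<in> P \<times> P. dist x y < dist a b} \<subset> {(x, y) \<in> P \<times> P. dist x y < dist u w}"
      by blast
    moreover have "finite {(x, y) \<in> P \<times> P. dist x y < dist u w}"
      by (rule finite_subset[of _ "P \<times> P"]) (use \<open>finite P\<close> in auto)
    ultimately show "card {(x, y) \<in> P \<times> P. dist x y < dist a b} <
        card {(x, y) \<in> P \<times> P. dist x y < dist u w}"
      by (rule psubset_card_mono[rotated])
  qed
  obtain i where i: "i < n" and
    "norm (w - u) * cos (pi / (2 * real n)) \<le> (w - u) \<bullet> bisector n i \<or>
     norm (w - u) * cos (pi / (2 * real n)) \<le> - (w - u) \<bullet> bisector n i"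
    using nearest_bisector[OF n(2), of "w - u"] by blast
  then consider "norm (w - u) * cos (pi / (2 * real n)) \<le> (w - u) \<bullet> bisector n i"
    | "norm (u - w) * cos (pi / (2 * real n)) \<le> (u - w) \<bullet> bisector n i"
    by (auto simp: norm_minus_commute)
  then show ?case
  proof cases
    case 1
    then show ?thesis
      using theta_conn_step[OF n(1) assms(3-5) less.prems i] IH by blast
  next
    case 2
    have "conn (theta_graph n P S) w u (ratio (pi / (2 * real n)) * dist w u)"
      using theta_conn_step[OF n(1) assms(3-5) less.prems(2,1) _ _ i 2] less.prems(3,4) IH
      by (simp add: dist_commute visible_commute)
    from conn_sym[OF theta_graph_commute this] show ?thesis
      by (simp add: dist_commute)
  qed
qed

theorem theorem6:
  fixes k x :: nat and P :: "pt set" and S :: "pt set set"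
  assumes "k \<ge> 1" and "x \<in> {3, 5}"
    and "finite P" and "general_position (4 * k + x) P" and "constraints P S"
  shows "let \<theta> = 2 * pi / real (4 * k + x) in
         is_spanner P (theta_graph (4 * k + x) P S) (vis_graph P S)
           (cos (\<theta> / 4) / (cos (\<theta> / 2) - sin (3 * \<theta> / 4)))"
proof -
  define n where "n = 4 * k + x"
  define \<delta> where "\<delta> = pi / (2 * real n)"
  define \<theta> where "\<theta> = 2 * pi / real n"
  \<comment> \<open>Oddness comes from \<open>x\<close>; the bound 6 is what gives
    \<open>5 * \<delta> < pi / 2\<close>.\<close>
  have n: "n \<ge> 6" "odd n"
    using assms(1,2) by (auto simp: n_def)
  have "\<theta> = 4 * \<delta>"
    by (simp add: \<theta>_def \<delta>_def)
  then have t: "cos (\<theta> / 4) / (cos (\<theta> / 2) - sin (3 * \<theta> / 4)) = ratio \<delta>"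
    by (simp add: ratio_def)
  have "0 < \<delta>" "5 * \<delta> < pi / 2"
    using n by (auto simp: \<delta>_def field_simps)
  then have ge1: "ratio \<delta> \<ge> 1"
    by (rule ratio_ge_1)
  have "vis_graph P S a b" if "theta_graph n P S a b" for a b
    using that visible_commute by (auto simp: theta_graph_def theta_half_def vis_graph_def)
  moreover have "conn (theta_graph n P S) a b (ratio \<delta> * dist a b)" if "vis_graph P S a b" for a b
    using theta_conn[OF n assms(3) _ assms(5)] assms(4) that
    by (simp add: vis_graph_def \<delta>_def n_def)
  then have "gdist (theta_graph n P S) a b \<le> ereal (ratio \<delta>) * gdist (vis_graph P S) a b" for a b
    using gdist_le_of_conn[of "ratio \<delta>" "vis_graph P S"] ge1 by simp
  ultimately have "is_spanner P (theta_graph n P S) (vis_graph P S) (ratio \<delta>)"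
    using ge1 by (simp add: is_spanner_def)
  then show ?thesis
    by (simp add: Let_def n_def[symmetric] \<theta>_def[symmetric] t)
qed

end
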